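(* Assume that the system is mean square detectable with respect to the sensing channel. Then there exists $Y^+\in\mathbb M$ satisfying the Filtering CARE $Y^+_n=\mathcal Y_n(Y^+)$, $n\in\mathbb S_\eta$, and such that $Y^+\succeq Y$ for all $Y\in\mathbb M$, if and only if there exists a solution $\widehat Y$ of the convex programming problem $$\max\ \mathrm{tr}\Big(\sum_{n=1}^{\mathbf I}Y_n\Big)$$ subject to $$\begin{bmatrix}-Y_n+\tilde{\mathcal A}_n(Y)&\tilde{\mathcal C}_n(Y)\\ \tilde{\mathcal C}_n(Y)^*&\tilde{\mathcal R}_n(Y)\end{bmatrix}\succeq0,\quad \tilde{\mathcal R}_n(Y)\succ0,\quad n\in\mathbb S_\eta,\qquad Y\in\mathbb H^{\mathbf In_x,*}.$$ Moreover, $\widehat Y=Y^+$.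
   Context: $\mathbb F$ is $\mathbb R$ or $\mathbb C$; $^*$ is conjugate transpose; $A\in\mathbb F^{n_x\times n_x}$, $L\in\mathbb F^{n_y\times n_x}$, $G\in\mathbb F^{n_x\times n_w}$, $H\in\mathbb F^{n_y\times n_w}$ with $GG^*\succeq0$, $GH^*=0$, $HH^*\succ0$. $Q=[q_{mn}]$ is the transition matrix of an ergodic (irreducible, aperiodic) Markov chain on $\mathbb S_\eta=\{1,\dots,\mathbf I\}$ with stationary distribution $(\pi_n^\infty)_n$, and $\hat\gamma_n\in[0,1]$ for $n\in\mathbb S_\eta$ (the packet delivery probability of the sensing channel in mode $n$). $\mathbb H^{\mathbf In_x,*}$ is the set of $\mathbf I$-tuples $Y=[Y_n]_{n=1}^{\mathbf I}$ of Hermitian $n_x\times n_x$ matrices over $\mathbb F$. Inequalities $\succeq,\succ$ between tuples are componentwise in the positive (semi)definite order. For a tuple $\mathbf S=[S_m]_{m=1}^{\mathbf I}$ of $n_x\times n_x$ matrices, $\mathcal D_n(\mathbf S)=\sum_{m=1}^{\mathbf I}q_{mn}S_m$. For $Y\in\mathbb H^{\mathbf In_x,*}$: $$\tilde{\mathcal A}_n(Y)=A\mathcal D_n(Y)A^*+\pi_n^\infty GG^*,\quad \tilde{\mathcal C}_n(Y)=\hat\gamma_n^{1/2}A\mathcal D_n(Y)L^*,\quad \tilde{\mathcal R}_n(Y)=\pi_n^\infty HH^*+L\mathcal D_n(Y)L^*.$$ $\mathbb L=\{Y\in\mathbb H^{\mathbf In_x,*}:\tilde{\mathcal R}_n(Y)\text{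 non-singular for all }n\in\mathbb S_\eta\}$. For $Y\in\mathbb L$, $\mathcal Y_n(Y)=\tilde{\mathcal A}_n(Y)-\tilde{\mathcal C}_n(Y)\tilde{\mathcal R}_n(Y)^{-1}\tilde{\mathcal C}_n(Y)^*$ and $\mathcal Y=[\mathcal Y_n]_{n=1}^{\mathbf I}$. The Filtering CARE is the set of equations $Y_n=\mathcal Y_n(Y)$, $n\in\mathbb S_\eta$. Finally, $$\mathbb M=\{Y\in\mathbb L:\ \tilde{\mathcal R}_n(Y)\succ0\ \text{for all }n\in\mathbb S_\eta,\ \text{and } -Y+\mathcal Y(Y)\succeq0\}.$$ Mean square detectability (with respect to the sensing channel): there exists $M=[M_n]_{n=1}^{\mathbf I}$, $M_n\in\mathbb F^{n_x\times n_y}$, such that $\rho(\mathcal V)<1$, where $\rho$ is the spectral radius and $\mathcal V=[\mathcal V_n]$ is the linear operator on $\mathbf I$-tuples of $n_x\times n_x$ matrices given by $\mathcal V_n(\mathbf S)=\hat\gamma_n(A+M_nL)\mathcal D_n(\mathbf S)(A+M_nL)^*+(1-\hat\gamma_n)A\mathcal D_n(\mathbf S)A^*$. *)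

theory Defs
  imports "HOL-Analysis.Analysis"
begin

text \<open>
  The scalar field \<open>F\<close>, real or complex, is a subset of the complex numbers: either \<open>\<real>\<close> or
  \<open>UNIV\<close>. A \<open>k \<times> l\<close> matrix over \<open>F\<close> has type \<open>complex^'l^'k\<close> and entries in \<open>F\<close>.
\<close>

definition vec_over :: "complex set \<Rightarrow> complex^'k \<Rightarrow> bool" where
  "vec_over F x \<longleftrightarrow> (\<forall>i. x $ i \<in> F)"

definition mat_over :: "complex set \<Rightarrow> complex^'l^'k \<Rightarrow> bool" where
  "mat_over F M \<longleftrightarrow> (\<forall>i j. M $ i $ j \<in> F)"

definition ctransp :: "complex^'l^'k \<Rightarrow> complex^'k^'l" where
  "ctransp M = (\<chi> i j. cnj (M $ j $ i))"

definition hermitian :: "complex^'k^'k \<Rightarrow> bool" where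
  "hermitian M \<longleftrightarrow> ctransp M = M"

text \<open>\<open>x\<^sup>* M x\<close>; for Hermitian \<open>M\<close> this number is real, so the real part below loses nothing.\<close>

definition quad_form :: "complex^'k^'k \<Rightarrow> complex^'k \<Rightarrow> real" where
  "quad_form M x = Re (\<Sum>i\<in>UNIV. cnj (x $ i) * (M *v x) $ i)"

definition psd :: "complex set \<Rightarrow> complex^'k^'k \<Rightarrow> bool" where
  "psd F M \<longleftrightarrow> hermitian M \<and> (\<forall>x. vec_over F x \<longrightarrow> 0 \<le> quad_form M x)"

definition pd :: "complex set \<Rightarrow> complex^'k^'k \<Rightarrow> bool" where
  "pd F M \<longleftrightarrow> hermitian M \<and> (\<forall>x. vec_over F x \<and> x \<noteq> 0 \<longrightarrow> 0 < quad_form M x)"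

definition block_mat ::
  "complex^'k^'k \<Rightarrow> complex^'l^'k \<Rightarrow> complex^'k^'l \<Rightarrow> complex^'l^'l \<Rightarrow> complex^('k + 'l)^('k + 'l)"
where
  "block_mat M11 M12 M21 M22 = (\<chi> i j.
     case i of
       Inl a \<Rightarrow> (case j of Inl b \<Rightarrow> M11 $ a $ b | Inr b \<Rightarrow> M12 $ a $ b)
     | Inr a \<Rightarrow> (case j of Inl b \<Rightarrow> M21 $ a $ b | Inr b \<Rightarrow> M22 $ a $ b))"


text \<open>
  Finite Markov chains. The mode set is the index type \<open>'i\<close>, and \<open>Q $ m $ n\<close> is the probability of a
  transition from \<open>m\<close> to \<open>n\<close>. Powers are written with \<open>**\<close> because \<open>*\<close> and \<open>^\<close> act
  componentwise on vectors and matrices.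
\<close>

definition mat_pow :: "real^'i^'i \<Rightarrow> nat \<Rightarrow> real^'i^'i" where
  "mat_pow Q k = (((**) Q) ^^ k) (mat 1)"

definition stochastic_matrix :: "real^'i^'i \<Rightarrow> bool" where
  "stochastic_matrix Q \<longleftrightarrow> (\<forall>m n. 0 \<le> Q $ m $ n) \<and> (\<forall>m. (\<Sum>n\<in>UNIV. Q $ m $ n) = 1)"

definition irreducible_chain :: "real^'i^'i \<Rightarrow> bool" where
  "irreducible_chain Q \<longleftrightarrow> (\<forall>m n. \<exists>k. 0 < mat_pow Q k $ m $ n)"

definition aperiodic_chain :: "real^'i^'i \<Rightarrow> bool" where
  "aperiodic_chain Q \<longleftrightarrow> (\<forall>n. Gcd {k. 0 < k \<and> 0 < mat_pow Q k $ n $ n} = 1)"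

definition ergodic_chain :: "real^'i^'i \<Rightarrow> bool" where
  "ergodic_chain Q \<longleftrightarrow> stochastic_matrix Q \<and> irreducible_chain Q \<and> aperiodic_chain Q"

definition stationary_distribution :: "real^'i^'i \<Rightarrow> real^'i \<Rightarrow> bool" where
  "stationary_distribution Q \<pi> \<longleftrightarrow>
     (\<forall>n. 0 \<le> \<pi> $ n) \<and> (\<Sum>n\<in>UNIV. \<pi> $ n) = 1 \<and> \<pi> v* Q = \<pi>"


text \<open>
  A tuple \<open>[S\<^sub>n]\<close> of matrices is a vector of type \<open>complex^'l^'k^'i\<close>.
\<close>

definition hermitian_tuples :: "complex set \<Rightarrow> (complex^'x^'x^'i) set" where
  "hermitian_tuples F = {Y. \<forall>n. mat_over F (Y $ n) \<and> hermitian (Y $ n)}"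

definition tuple_ge :: "complex set \<Rightarrow> complex^'x^'x^'i \<Rightarrow> complex^'x^'x^'i \<Rightarrow> bool" where
  "tuple_ge F Y Z \<longleftrightarrow> (\<forall>n. psd F (Y $ n - Z $ n))"

definition D_op :: "real^'i^'i \<Rightarrow> complex^'x^'x^'i \<Rightarrow> 'i \<Rightarrow> complex^'x^'x" where
  "D_op Q S n = (\<Sum>m\<in>UNIV. Q $ m $ n *\<^sub>R S $ m)"

definition A_op ::
  "complex^'x^'x \<Rightarrow> complex^'w^'x \<Rightarrow> real^'i^'i \<Rightarrow> real^'i \<Rightarrow> complex^'x^'x^'i \<Rightarrow> 'i
     \<Rightarrow> complex^'x^'x"
where
  "A_op A G Q \<pi> Y n = A ** D_op Q Y n ** ctransp A + \<pi> $ n *\<^sub>R (G ** ctransp G)"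

definition C_op ::
  "complex^'x^'x \<Rightarrow> complex^'x^'y \<Rightarrow> real^'i^'i \<Rightarrow> real^'i \<Rightarrow> complex^'x^'x^'i \<Rightarrow> 'i
     \<Rightarrow> complex^'y^'x"
where
  "C_op A L Q \<gamma> Y n = sqrt (\<gamma> $ n) *\<^sub>R (A ** D_op Q Y n ** ctransp L)"

definition R_op ::
  "complex^'x^'y \<Rightarrow> complex^'w^'y \<Rightarrow> real^'i^'i \<Rightarrow> real^'i \<Rightarrow> complex^'x^'x^'i \<Rightarrow> 'i
     \<Rightarrow> complex^'y^'y"
where
  "R_op L H Q \<pi> Y n = \<pi> $ n *\<^sub>R (H ** ctransp H) + L ** D_op Q Y n ** ctransp L"

definition L_set ::
  "complex set \<Rightarrow> complex^'x^'y \<Rightarrow> complex^'w^'y \<Rightarrow> real^'i^'i \<Rightarrow> real^'i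
     \<Rightarrow> (complex^'x^'x^'i) set"
where
  "L_set F L H Q \<pi> = {Y \<in> hermitian_tuples F. \<forall>n. invertible (R_op L H Q \<pi> Y n)}"

definition Y_op ::
  "complex^'x^'x \<Rightarrow> complex^'x^'y \<Rightarrow> complex^'w^'x \<Rightarrow> complex^'w^'y \<Rightarrow> real^'i^'i \<Rightarrow> real^'i
     \<Rightarrow> real^'i \<Rightarrow> complex^'x^'x^'i \<Rightarrow> complex^'x^'x^'i"
where
  "Y_op A L G H Q \<pi> \<gamma> Y = (\<chi> n. A_op A G Q \<pi> Y n
     - C_op A L Q \<gamma> Y n ** matrix_inv (R_op L H Q \<pi> Y n) ** ctransp (C_op A L Q \<gamma> Y n))"

definition M_set ::
  "complex set \<Rightarrow> complex^'x^'x \<Rightarrow> complex^'x^'y \<Rightarrow> complex^'w^'x \<Rightarrow> complex^'w^'y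
     \<Rightarrow> real^'i^'i \<Rightarrow> real^'i \<Rightarrow> real^'i \<Rightarrow> (complex^'x^'x^'i) set"
where
  "M_set F A L G H Q \<pi> \<gamma> = {Y \<in> L_set F L H Q \<pi>.
     (\<forall>n. pd F (R_op L H Q \<pi> Y n)) \<and> tuple_ge F (- Y + Y_op A L G H Q \<pi> \<gamma> Y) 0}"

definition filtering_CARE ::
  "complex^'x^'x \<Rightarrow> complex^'x^'y \<Rightarrow> complex^'w^'x \<Rightarrow> complex^'w^'y \<Rightarrow> real^'i^'i \<Rightarrow> real^'i
     \<Rightarrow> real^'i \<Rightarrow> complex^'x^'x^'i \<Rightarrow> bool"
where
  "filtering_CARE A L G H Q \<pi> \<gamma> Y \<longleftrightarrow> (\<forall>n. Y $ n = Y_op A L G H Q \<pi> \<gamma> Y $ n)"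

definition maximal_CARE_solution ::
  "complex set \<Rightarrow> complex^'x^'x \<Rightarrow> complex^'x^'y \<Rightarrow> complex^'w^'x \<Rightarrow> complex^'w^'y
     \<Rightarrow> real^'i^'i \<Rightarrow> real^'i \<Rightarrow> real^'i \<Rightarrow> complex^'x^'x^'i \<Rightarrow> bool"
where
  "maximal_CARE_solution F A L G H Q \<pi> \<gamma> Y \<longleftrightarrow>
     Y \<in> M_set F A L G H Q \<pi> \<gamma> \<and> filtering_CARE A L G H Q \<pi> \<gamma> Y \<and>
     (\<forall>Z \<in> M_set F A L G H Q \<pi> \<gamma>. tuple_ge F Y Z)"


definition LMI_feasible ::
  "complex set \<Rightarrow> complex^'x^'x \<Rightarrow> complex^'x^'y \<Rightarrow> complex^'w^'x \<Rightarrow> complex^'w^'y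
     \<Rightarrow> real^'i^'i \<Rightarrow> real^'i \<Rightarrow> real^'i \<Rightarrow> (complex^'x^'x^'i) set"
where
  "LMI_feasible F A L G H Q \<pi> \<gamma> = {Y \<in> hermitian_tuples F. \<forall>n.
     psd F (block_mat (- (Y $ n) + A_op A G Q \<pi> Y n) (C_op A L Q \<gamma> Y n)
                      (ctransp (C_op A L Q \<gamma> Y n)) (R_op L H Q \<pi> Y n)) \<and>
     pd F (R_op L H Q \<pi> Y n)}"

text \<open>The trace of a Hermitian matrix is real.\<close>

definition trace_objective :: "complex^'x^'x^'i \<Rightarrow> real" where
  "trace_objective Y = Re (trace (\<Sum>n\<in>UNIV. Y $ n))"

definition convex_program_solution ::
  "complex set \<Rightarrow> complex^'x^'x \<Rightarrow> complex^'x^'y \<Rightarrow> complex^'w^'x \<Rightarrow> complex^'w^'y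
     \<Rightarrow> real^'i^'i \<Rightarrow> real^'i \<Rightarrow> real^'i \<Rightarrow> complex^'x^'x^'i \<Rightarrow> bool"
where
  "convex_program_solution F A L G H Q \<pi> \<gamma> Y \<longleftrightarrow>
     Y \<in> LMI_feasible F A L G H Q \<pi> \<gamma> \<and>
     (\<forall>Z \<in> LMI_feasible F A L G H Q \<pi> \<gamma>. trace_objective Z \<le> trace_objective Y)"


definition V_op ::
  "complex^'x^'x \<Rightarrow> complex^'x^'y \<Rightarrow> real^'i^'i \<Rightarrow> real^'i \<Rightarrow> complex^'y^'x^'i
     \<Rightarrow> complex^'x^'x^'i \<Rightarrow> complex^'x^'x^'i"
where
  "V_op A L Q \<gamma> M S = (\<chi> n.
     \<gamma> $ n *\<^sub>R ((A + M $ n ** L) ** D_op Q S n ** ctransp (A + M $ n ** L))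
     + (1 - \<gamma> $ n) *\<^sub>R (A ** D_op Q S n ** ctransp A))"

text \<open>
  Spectral radius of a complex-linear operator on tuples of complex matrices: the space is nonzero
  and finite-dimensional, so the spectrum is the finite nonempty set of eigenvalues. When \<open>F\<close> is
  \<open>\<real>\<close>, \<open>V_op\<close> on complex tuples is the complexification of the operator on real tuples, whose
  spectral radius is by convention that of the complexification.
\<close>

definition operator_eigenvalue ::
  "(complex^'x^'x^'i \<Rightarrow> complex^'x^'x^'i) \<Rightarrow> complex \<Rightarrow> bool"
where
  "operator_eigenvalue T \<mu> \<longleftrightarrow>
     (\<exists>S. S \<noteq> 0 \<and> T S = (\<chi> n i j. \<mu> * S $ n $ i $ j))"

definition operator_spectral_radius :: "(complex^'x^'x^'i \<Rightarrow> complex^'x^'x^'i) \<Rightarrow> real" where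
  "operator_spectral_radius T = Max (cmod ` {\<mu>. operator_eigenvalue T \<mu>})"

definition mean_square_detectable ::
  "complex set \<Rightarrow> complex^'x^'x \<Rightarrow> complex^'x^'y \<Rightarrow> real^'i^'i \<Rightarrow> real^'i \<Rightarrow> bool"
where
  "mean_square_detectable F A L Q \<gamma> \<longleftrightarrow>
     (\<exists>M :: complex^'y^'x^'i. (\<forall>n. mat_over F (M $ n)) \<and>
        operator_spectral_radius (V_op A L Q \<gamma> M) < 1)"

end

theory Submission
  imports Defs
begin

text \<open>
  The maximal solution always exists. By completing the square, the Riccati operator is the minimum,
  over all gains, of monotone affine maps; hence it is monotone wherever the innovation covariances
  are positive definite. Detectability provides a gain whose affine map has a fixed point
  dominating every feasible tuple. Among the tuples that dominate the feasible set, are decreased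
  by the Riccati operator and have trace at most that of this fixed point, one has minimal trace by
  compactness. The Riccati operator maps that set into itself, so the minimiser is a solution of
  the CARE. A Schur complement identifies the feasible set of the convex program with
  \<open>M_set\<close>, and a positive semidefinite matrix of trace zero vanishes, so the maximal
  solution is the only maximiser of the trace.
\<close>

section \<open>Positive resolvents and eigenvalues\<close>

text \<open>Three obstacles shape the argument. The spectral radius is a maximum of eigenvalue
  moduli, with no estimate on powers attached. All that is drawn from it is that no real number
  \<open>1 / s\<close> with \<open>0 < s \<le> 1\<close> is an eigenvalue of the closed-loop
  operator \<open>V\<close>; as \<open>V\<close> preserves the semidefinite cone, a homotopy in
  \<open>s\<close> turns this into positivity of the inverse of \<open>I - V\<close>, replacing a
  Neumann series. The Riccati operator contains an inverse and is monotone only where the innovation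
  covariances are positive definite. The zero tuple is feasible, so everything that dominates the
  feasible set is positive semidefinite and stays in that region. An attained minimum of the trace
  then replaces the limit of a decreasing Riccati iteration. For real scalars the order refers to
  real test vectors only. On matrices with entries in \<open>F\<close> it agrees with the complex
  order, so all inequalities are proved over \<open>UNIV\<close>, while the equations are solved
  inside the real subspace of Hermitian tuples over \<open>F\<close>.\<close>

lemma linear_inj_on_subspace_imp_onto:
  fixes f :: "'a::euclidean_space \<Rightarrow> 'a"
  assumes f: "linear f" and S: "subspace S" and maps: "f ` S \<subseteq> S"
    and inj: "\<And>x. x \<in> S \<Longrightarrow> f x = 0 \<Longrightarrow> x = 0"
  shows "f ` S = S"
proof -
  have "inj_on f (span S)"
    using inj S by (subst linear_inj_on_iff_eq_0[OF f]) (auto simp: span_eq_iff[THEN iffD2])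
  then have "dim (f ` S) = dim S"
    by (rule dim_image_eq[OF f])
  moreover have "subspace (f ` S)"
    by (rule linear_subspace_image[OF f S])
  ultimately show ?thesis
    using subspace_dim_equal[of "f ` S" S] S maps by simp
qed

text \<open>
  A Perron-Frobenius argument without powers of \<open>V\<close>: the solution of \<open>x - s V x = p + \<epsilon> e\<close> depends
  continuously on \<open>s\<close>, lies in the cone at \<open>s = 0\<close>, and cannot leave it, since a solution in the
  cone dominates the interior point \<open>\<epsilon> e\<close>.
\<close>

lemma positive_resolvent_order_unit:
  fixes V :: "'a::euclidean_space \<Rightarrow> 'a"
  assumes V: "linear V" and S: "subspace S" and VS: "V ` S \<subseteq> S"
    and inj: "\<And>s x. 0 \<le> s \<Longrightarrow> s \<le> 1 \<Longrightarrow> x \<in> S \<Longrightarrow> x = s *\<^sub>R V x \<Longrightarrow> x = 0"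
    and C: "C \<subseteq> S" "closed C" "\<And>x y. x \<in> C \<Longrightarrow> y \<in> C \<Longrightarrow> x + y \<in> C"
      "\<And>c x. 0 \<le> c \<Longrightarrow> x \<in> C \<Longrightarrow> c *\<^sub>R x \<in> C"
    and VC: "V ` C \<subseteq> C"
    and e: "\<delta> > 0" "e \<in> S" "\<And>x. x \<in> S \<Longrightarrow> norm (x - e) < \<delta> \<Longrightarrow> x \<in> C"
    and eps: "\<epsilon> > 0" and p: "p \<in> C" and w: "w \<in> S" "w - V w = p + \<epsilon> *\<^sub>R e"
  shows "w \<in> C"
proof -
  define b where "b = p + \<epsilon> *\<^sub>R e"
  have eC: "e \<in> C"
    using e by simp
  have bS: "b \<in> S"
    unfolding b_def using p C(1) e S by (auto intro: subspace_add subspace_scale)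
  have lin: "linear (\<lambda>x. x - s *\<^sub>R V x)" for s
    by (intro linear_compose_sub linear_id[unfolded id_def] linear_compose_scale_right V)
  have onto: "(\<lambda>x. x - s *\<^sub>R V x) ` S = S" if "s \<in> {0..1}" for s
    using that VS S inj
    by (intro linear_inj_on_subspace_imp_onto lin S)
       (auto intro!: subspace_diff subspace_scale)
  then have "\<forall>s\<in>{0..1}. \<exists>x\<in>S. x - s *\<^sub>R V x = b"
    using bS by (metis (no_types, lifting) imageE)
  then obtain f where f: "\<And>s. s \<in> {0..1} \<Longrightarrow> f s \<in> S"
      "\<And>s. s \<in> {0..1} \<Longrightarrow> f s - s *\<^sub>R V (f s) = b"
    by (metis (no_types, lifting))
  obtain B where B: "B > 0" "\<And>x. norm (V x) \<le> B * norm x"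
    using linear_bounded_pos[OF V] by blast
  have cont: "continuous_on {0..1} f"
    unfolding continuous_on_def
  proof
    fix s :: real assume s: "s \<in> {0..1}"
    have "\<exists>c>0. \<forall>x\<in>S. norm (x - s *\<^sub>R V x) \<ge> c * norm x"
      using inj s lin S by (intro injective_imp_isometric)
        (auto intro: closed_subspace simp: linear_conv_bounded_linear[symmetric])
    then obtain c where c: "c > 0" "\<And>x. x \<in> S \<Longrightarrow> norm (x - s *\<^sub>R V x) \<ge> c * norm x"
      by blast
    have bound: "c * norm (f t - f s) \<le> \<bar>t - s\<bar> * (B * (norm (f s) + norm (f t - f s)))"
      if t: "t \<in> {0..1}" for t
    proof -
      have "(f t - f s) - s *\<^sub>R V (f t - f s)
          = (f t - t *\<^sub>R V (f t)) - (f s - s *\<^sub>R V (f s)) + (t - s) *\<^sub>R V (f t)"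
        by (simp add: linear_diff[OF V] algebra_simps)
      then have "(f t - f s) - s *\<^sub>R V (f t - f s) = (t - s) *\<^sub>R V (f t)"
        by (simp only: f(2)[OF t] f(2)[OF s] diff_self add_0)
      then have "c * norm (f t - f s) \<le> \<bar>t - s\<bar> * norm (V (f t))"
        using c(2)[of "f t - f s"] f(1) s t S by (simp add: subspace_diff)
      also have "norm (V (f t)) \<le> B * norm (f t)"
        by (rule B)
      also have "norm (f t) \<le> norm (f s) + norm (f t - f s)"
        using norm_triangle_ineq[of "f s" "f t - f s"] by simp
      finally show ?thesis
        using B(1) by (simp add: mult_left_mono)
    qed
    have "((\<lambda>t. (2 / c) * (\<bar>t - s\<bar> * (B * norm (f s)))) \<longlongrightarrow> (2 / c) * (\<bar>s - s\<bar> * (B * norm (f s)))) (at s within {0..1})"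
      by (intro tendsto_intros)
    then have "((\<lambda>t. (2 / c) * (\<bar>t - s\<bar> * (B * norm (f s)))) \<longlongrightarrow> 0) (at s within {0..1})"
      by (simp only: diff_self abs_zero mult_zero_left mult_zero_right)
    \<comment> \<open>Within distance \<open>c / (2 * B)\<close> of \<open>s\<close>, the part of
      \<open>bound\<close> with \<open>norm (f t - f s)\<close> on the right is at most half of the
      left side and is absorbed; hence the factor 2.\<close>
    moreover have "eventually (\<lambda>t. norm (f t - f s) \<le> (2 / c) * (\<bar>t - s\<bar> * (B * norm (f s)))) (at s within {0..1})"
      unfolding eventually_at
    proof (rule exI[of _ "c / (2 * B)"], rule conjI, simp add: c(1) B(1), rule ballI, rule impI)
      fix t assume "t \<in> {0..1}" and t: "t \<noteq> s \<and> dist t s < c / (2 * B)"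
      have "\<bar>t - s\<bar> * B \<le> c / 2"
        using t B(1) by (simp add: dist_real_def pos_less_divide_eq)
      from mult_right_mono[OF this, of "norm (f t - f s)"]
      have "\<bar>t - s\<bar> * B * norm (f t - f s) \<le> c / 2 * norm (f t - f s)"
        by simp
      then have "c / 2 * norm (f t - f s) \<le> \<bar>t - s\<bar> * (B * norm (f s))"
        using bound[OF \<open>t \<in> {0..1}\<close>] by (simp add: algebra_simps)
      then show "norm (f t - f s) \<le> (2 / c) * (\<bar>t - s\<bar> * (B * norm (f s)))"
        using mult_left_mono[of _ _ "2 / c"] c(1) by fastforce
    qed
    ultimately have "((\<lambda>t. f t - f s) \<longlongrightarrow> 0) (at s within {0..1})"
      by (rule Lim_null_comparison[rotated])
    then show "(f \<longlongrightarrow> f s) (at s within {0..1})"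
      by (simp only: LIM_zero_iff)
  qed
  define J where "J = {0..1} \<inter> f -` C"
  have "closedin (top_of_set {0..1}) J"
    unfolding J_def using cont C(2) by (rule continuous_closedin_preimage)
  moreover have "openin (top_of_set {0..1}) J"
    unfolding openin_euclidean_subtopology_iff
  proof (intro conjI ballI)
    fix s assume "s \<in> J"
    then have s: "s \<in> {0..1}" "f s \<in> C"
      by (auto simp: J_def)
    obtain d where d: "d > 0" "\<And>t. t \<in> {0..1} \<Longrightarrow> dist t s < d \<Longrightarrow> dist (f t) (f s) < \<epsilon> * \<delta>"
      using cont[unfolded continuous_on_iff, rule_format, OF s(1) mult_pos_pos[OF eps e(1)]] by blast
    have "t \<in> J" if t: "t \<in> {0..1}" "dist t s < d" for t
    proof -
      \<comment> \<open>The whole displacement \<open>f t - f s\<close> is charged to the interior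
        point: in the equation for \<open>f s\<close>, replacing \<open>e\<close> by
        \<open>z\<close> yields \<open>f t\<close>. The threshold
        \<open>\<epsilon> * \<delta>\<close> keeps \<open>z\<close> within \<open>\<delta>\<close>
        of \<open>e\<close>.\<close>
      define z where "z = e + (1 / \<epsilon>) *\<^sub>R (f t - f s)"
      have "z - e = (1 / \<epsilon>) *\<^sub>R (f t - f s)"
        by (simp add: z_def)
      then have "norm (z - e) = norm (f t - f s) / \<epsilon>"
        using eps by simp
      then have "norm (z - e) < \<delta>"
        using d(2)[OF t] eps by (simp add: dist_norm pos_divide_less_eq mult.commute)
      moreover have "z \<in> S"
        unfolding z_def using f(1) s(1) t(1) e(2) S
        by (auto intro!: subspace_add subspace_scale subspace_diff)
      ultimately have z: "z \<in> C"
        by (rule e(3)[rotated])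
      have "f t = (s *\<^sub>R V (f s) + p) + \<epsilon> *\<^sub>R z"
        using f(2)[OF s(1)] eps unfolding z_def b_def by (simp add: algebra_simps)
      moreover have "V (f s) \<in> C"
        using VC s by blast
      ultimately have "f t \<in> C"
        using s(1) p z eps by (auto intro!: C)
      then show ?thesis
        using t by (simp add: J_def)
    qed
    then show "\<exists>d>0. \<forall>t\<in>{0..1}. dist t s < d \<longrightarrow> t \<in> J"
      using d(1) by blast
  qed (auto simp: J_def)
  moreover have "0 \<in> J"
    using f(2)[of 0] p eC eps by (auto simp: J_def b_def intro!: C)
  ultimately have "J = {0..1}"
    using connected_Icc[of "0::real" 1] unfolding connected_clopen by blast
  then have "1 \<in> J"
    by simp
  then have "f 1 \<in> C"
    unfolding J_def by blast
  moreover have "w - f 1 = 0"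
  proof (rule inj[of 1])
    show "w - f 1 \<in> S"
      by (rule subspace_diff[OF S w(1) f(1)]) simp
    show "w - f 1 = 1 *\<^sub>R V (w - f 1)"
    proof -
      have "w - f 1 - V (w - f 1) = (w - V w) - (f 1 - 1 *\<^sub>R V (f 1))"
        by (simp add: linear_diff[OF V])
      also have "\<dots> = 0"
        by (subst f(2)) (simp_all only: w(2) b_def diff_self, simp)
      finally show ?thesis
        by simp
    qed
  qed auto
  ultimately show ?thesis
    by simp
qed

text \<open>With \<open>u - V u = e\<close>, the perturbed \<open>w + \<epsilon> u\<close> has
  right-hand side \<open>(w - V w) + \<epsilon> e\<close>, so the preceding lemma puts it in the
  cone; closedness allows \<open>\<epsilon>\<close> to tend to 0. The vector \<open>u\<close> itself
  need not be known to lie in the cone.\<close>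

lemma positive_resolvent:
  fixes V :: "'a::euclidean_space \<Rightarrow> 'a"
  assumes V: "linear V" and S: "subspace S" and VS: "V ` S \<subseteq> S"
    and inj: "\<And>s x. 0 \<le> s \<Longrightarrow> s \<le> 1 \<Longrightarrow> x \<in> S \<Longrightarrow> x = s *\<^sub>R V x \<Longrightarrow> x = 0"
    and C: "C \<subseteq> S" "closed C" "\<And>x y. x \<in> C \<Longrightarrow> y \<in> C \<Longrightarrow> x + y \<in> C"
      "\<And>c x. 0 \<le> c \<Longrightarrow> x \<in> C \<Longrightarrow> c *\<^sub>R x \<in> C"
    and VC: "V ` C \<subseteq> C"
    and e: "\<delta> > 0" "e \<in> S" "\<And>x. x \<in> S \<Longrightarrow> norm (x - e) < \<delta> \<Longrightarrow> x \<in> C"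
    and w: "w \<in> S" "w - V w \<in> C"
  shows "w \<in> C"
proof -
  have lin: "linear (\<lambda>x. x - V x)"
    by (intro linear_compose_sub linear_id[unfolded id_def] V)
  have "(\<lambda>x. x - V x) ` S = S"
    using VS S inj[of 1]
    by (intro linear_inj_on_subspace_imp_onto lin S) (auto intro!: subspace_diff)
  then obtain u where u: "u \<in> S" "u - V u = e"
    using e(2) by (metis (no_types, lifting) imageE)
  have "w + inverse (real (Suc n)) *\<^sub>R u \<in> C" for n
  proof (rule positive_resolvent_order_unit[OF V S VS inj C VC e _ w(2)])
    show "w + inverse (real (Suc n)) *\<^sub>R u \<in> S"
      using w u S by (auto intro: subspace_add subspace_scale)
    have "w + c *\<^sub>R u - V (w + c *\<^sub>R u) = w - V w + c *\<^sub>R (u - V u)" for c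
      by (simp add: linear_add[OF V] linear_scale[OF V] algebra_simps)
    then show "w + inverse (real (Suc n)) *\<^sub>R u - V (w + inverse (real (Suc n)) *\<^sub>R u)
        = w - V w + inverse (real (Suc n)) *\<^sub>R e"
      using u by simp
  qed (auto simp del: of_nat_Suc)
  moreover have "(\<lambda>n. w + inverse (real (Suc n)) *\<^sub>R u) \<longlonglongrightarrow> w + 0 *\<^sub>R u"
    by (intro tendsto_intros LIMSEQ_inverse_real_of_nat)
  ultimately have "w + 0 *\<^sub>R u \<in> C"
    by (rule closed_sequentially[OF C(2)])
  then show ?thesis
    by simp
qed

section \<open>Eigenvalues of complex-linear operators on tuples\<close>

definition complex_scale :: "complex \<Rightarrow> complex^'l^'k^'i \<Rightarrow> complex^'l^'k^'i" where
  "complex_scale c S = (\<chi> n i j. c * S $ n $ i $ j)"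

text \<open>Applying \<open>T - \<nu>\<close> to the sum kills the \<open>\<nu>\<close> term and
  rescales the others by \<open>\<mu> - \<nu> \<noteq> 0\<close>, so the induction must allow
  arbitrary eigenvectors. Since \<open>linear\<close> means real-linear, complex linearity enters as
  commutation with \<open>complex_scale\<close>.\<close>

lemma eigenvectors_sum_zero:
  fixes v :: "complex \<Rightarrow> complex^'x^'x^'i"
  assumes T: "linear T"
    and "finite I" "\<And>\<mu>. \<mu> \<in> I \<Longrightarrow> T (v \<mu>) = complex_scale \<mu> (v \<mu>)" "(\<Sum>\<mu>\<in>I. v \<mu>) = 0" "\<mu> \<in> I"
    and Tc: "\<And>c x. T (complex_scale c x) = complex_scale c (T x)"
  shows "v \<mu> = 0"
  using assms(2-5)
proof (induction I arbitrary: v \<mu> rule: finite_induct)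
  case (insert \<nu> I)
  have cs: "complex_scale c (\<Sum>\<mu>\<in>J. u \<mu>) = (\<Sum>\<mu>\<in>J. complex_scale c (u \<mu>))"
    for c J and u :: "complex \<Rightarrow> complex^'x^'x^'i"
    by (simp add: complex_scale_def vec_eq_iff sum_distrib_left)
  have "0 = T (\<Sum>\<mu>\<in>insert \<nu> I. v \<mu>) - complex_scale \<nu> (\<Sum>\<mu>\<in>insert \<nu> I. v \<mu>)"
    by (simp only: insert.prems(2) linear_0[OF T]) (simp add: complex_scale_def vec_eq_iff)
  also have "\<dots> = (\<Sum>\<mu>\<in>insert \<nu> I. T (v \<mu>) - complex_scale \<nu> (v \<mu>))"
    unfolding cs by (simp only: linear_sum[OF T] sum_subtractf)
  also have "\<dots> = (\<Sum>\<mu>\<in>insert \<nu> I. complex_scale (\<mu> - \<nu>) (v \<mu>))"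
    using insert.prems by (intro sum.cong) (auto simp: complex_scale_def vec_eq_iff algebra_simps)
  also have "\<dots> = (\<Sum>\<mu>\<in>I. complex_scale (\<mu> - \<nu>) (v \<mu>))"
    using insert.hyps by (simp add: complex_scale_def vec_eq_iff)
  finally have sum0: "(\<Sum>\<mu>\<in>I. complex_scale (\<mu> - \<nu>) (v \<mu>)) = 0"
    by simp
  have *: "v \<mu> = 0" if "\<mu> \<in> I" for \<mu>
  proof -
    have "complex_scale (\<mu> - \<nu>) (v \<mu>) = 0"
    proof (rule insert.IH[OF _ sum0 that])
      fix \<mu> assume "\<mu> \<in> I"
      then show "T (complex_scale (\<mu> - \<nu>) (v \<mu>)) = complex_scale \<mu> (complex_scale (\<mu> - \<nu>) (v \<mu>))"
        using insert.prems(1) by (simp add: Tc) (simp add: complex_scale_def vec_eq_iff)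
    qed
    moreover have "\<mu> \<noteq> \<nu>"
      using that insert.hyps by auto
    ultimately show ?thesis
      by (simp add: complex_scale_def vec_eq_iff)
  qed
  show ?case
    using insert * by auto
qed simp

text \<open>Makes the \<open>Max\<close> in \<open>operator_spectral_radius\<close> an upper bound.
  One eigenvector per eigenvalue gives an independent family in a finite-dimensional real space:
  real coefficients can be absorbed into the eigenvectors.\<close>

lemma finite_eigenvalues:
  fixes T :: "complex^'x^'x^'i \<Rightarrow> complex^'x^'x^'i"
  assumes T: "linear T" and Tc: "\<And>c x. T (complex_scale c x) = complex_scale c (T x)"
  shows "finite {\<mu>. operator_eigenvalue T \<mu>}"
proof -
  let ?E = "{\<mu>. operator_eigenvalue T \<mu>}"
  have "\<forall>\<mu>\<in>?E. \<exists>S. S \<noteq> 0 \<and> T S = complex_scale \<mu> S"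
    by (simp add: operator_eigenvalue_def complex_scale_def)
  from bchoice[OF this]
  obtain v where v: "\<And>\<mu>. \<mu> \<in> ?E \<Longrightarrow> v \<mu> \<noteq> 0 \<and> T (v \<mu>) = complex_scale \<mu> (v \<mu>)"
    by blast
  have inj: "inj_on v ?E"
  proof (rule inj_onI)
    fix \<mu> \<nu> assume *: "\<mu> \<in> ?E" "\<nu> \<in> ?E" "v \<mu> = v \<nu>"
    then have "complex_scale \<mu> (v \<mu>) = complex_scale \<nu> (v \<mu>)"
      using v by metis
    moreover obtain n i j where "v \<mu> $ n $ i $ j \<noteq> 0"
      using v[OF *(1)] by (auto simp: vec_eq_iff)
    ultimately show "\<mu> = \<nu>"
      by (auto simp: complex_scale_def vec_eq_iff)
  qed
  have "independent (v ` ?E)"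
  proof
    assume "dependent (v ` ?E)"
    then obtain t u where tu: "finite t" "t \<subseteq> v ` ?E" "(\<Sum>x\<in>t. u x *\<^sub>R x) = 0" "\<exists>x\<in>t. u x \<noteq> 0"
      unfolding real_vector.dependent_explicit by blast
    then obtain I where I: "I \<subseteq> ?E" "finite I" "t = v ` I"
      using finite_subset_image[OF tu(1,2)] by blast
    have "(\<Sum>\<mu>\<in>I. u (v \<mu>) *\<^sub>R v \<mu>) = 0"
      using tu(3) inj I by (simp add: sum.reindex inj_on_subset)
    moreover have "T (u (v \<mu>) *\<^sub>R v \<mu>) = complex_scale \<mu> (u (v \<mu>) *\<^sub>R v \<mu>)" if "\<mu> \<in> I" for \<mu>
      using v[of \<mu>] that I by (auto simp: linear_scale[OF T] complex_scale_def vec_eq_iff)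
    ultimately have "u (v \<mu>) *\<^sub>R v \<mu> = 0" if "\<mu> \<in> I" for \<mu>
      using eigenvectors_sum_zero[OF T I(2), of "\<lambda>\<mu>. u (v \<mu>) *\<^sub>R v \<mu>"] that Tc by blast
    then show False
      using tu(4) I v by fastforce
  qed
  then have "finite (v ` ?E)"
    by (rule independent_imp_finite)
  then show ?thesis
    using inj finite_imageD by blast
qed

text \<open>A nonzero solution would be an eigenvector for \<open>1 / s\<close>, whose modulus is at
  least 1.\<close>

lemma no_eigenvalue_outside_disc:
  fixes T :: "complex^'x^'x^'i \<Rightarrow> complex^'x^'x^'i"
  assumes T: "linear T" "\<And>c x. T (complex_scale c x) = complex_scale c (T x)"
    and r: "operator_spectral_radius T < 1"
    and s: "0 \<le> s" "s \<le> 1" and x: "x = s *\<^sub>R T x"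
  shows "x = 0"
proof (rule ccontr)
  assume "x \<noteq> 0"
  then have "s \<noteq> 0"
    using x by auto
  then have "(1 / s) *\<^sub>R x = T x"
    by (subst x) simp
  then have "T x = (\<chi> n i j. complex_of_real (1 / s) * x $ n $ i $ j)"
    by (auto simp: vec_eq_iff scaleR_conv_of_real[where 'a=complex])
  then have ev: "operator_eigenvalue T (of_real (1 / s))"
    unfolding operator_eigenvalue_def using \<open>x \<noteq> 0\<close> by blast
  have "cmod (of_real (1 / s)) \<le> operator_spectral_radius T"
    unfolding operator_spectral_radius_def
    by (rule Max_ge) (use finite_eigenvalues[OF T] ev in auto)
  moreover have "cmod (of_real (1 / s)) \<ge> 1"
    using s \<open>s \<noteq> 0\<close> by (simp add: norm_divide field_simps)
  ultimately show False
    using r by simp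
qed

section \<open>Complex matrices and their quadratic forms\<close>

lemma mmul_simps:
  fixes X :: "complex^'b^'a" and Y Z :: "complex^'c^'b" and V W :: "complex^'b^'a" and Y' :: "complex^'c^'b"
  shows "X ** (Y - Z) = X ** Y - X ** Z" "(V - W) ** Y' = V ** Y' - W ** Y'"
    "(V + W) ** Y' = V ** Y' + W ** Y'" "X ** (- Y) = - (X ** Y)" "(- V) ** Y' = - (V ** Y')"
    "X ** (c *\<^sub>R Y) = c *\<^sub>R (X ** Y)" "(c *\<^sub>R X) ** Y = c *\<^sub>R (X ** Y)"
    "X ** 0 = 0" "0 ** Y = 0"
  by (simp_all add: matrix_matrix_mult_def vec_eq_iff algebra_simps sum.distrib sum_subtractf
      sum_negf scaleR_sum_right)

lemma ctransp_simps [simp]: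
  "ctransp (ctransp X) = X" "ctransp (X + Y) = ctransp X + ctransp Y"
  "ctransp (X - Y) = ctransp X - ctransp Y" "ctransp (- X) = - ctransp X"
  "ctransp (c *\<^sub>R X) = c *\<^sub>R ctransp X" "ctransp 0 = 0" "ctransp (mat 1) = mat 1"
  by (auto simp: ctransp_def vec_eq_iff mat_def)

lemma ctransp_mult: "ctransp (X ** Y) = ctransp Y ** ctransp X"
  by (simp add: ctransp_def vec_eq_iff matrix_matrix_mult_def mult.commute)

lemma ctransp_sum: "ctransp (\<Sum>i\<in>I. X i) = (\<Sum>i\<in>I. ctransp (X i))"
  by (simp add: ctransp_def vec_eq_iff)

definition cinner :: "complex^'k \<Rightarrow> complex^'k \<Rightarrow> complex" where
  "cinner x y = (\<Sum>i\<in>UNIV. cnj (x $ i) * y $ i)"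

lemma cinner_simps:
  "cinner (x + y) z = cinner x z + cinner y z" "cinner z (x + y) = cinner z x + cinner z y"
  "cinner z (x - y) = cinner z x - cinner z y" "cinner z (- x) = - cinner z x"
  "cinner z (c *\<^sub>R x) = c *\<^sub>R cinner z x" "cinner z 0 = 0"
  "cinner (a *s x) y = cnj a * cinner x y" "cinner x (a *s y) = a * cinner x y"
  by (simp_all add: cinner_def algebra_simps sum.distrib sum_subtractf sum_negf sum_distrib_left
      scaleR_sum_right)

lemma cinner_commute: "cinner y x = cnj (cinner x y)"
  by (simp add: cinner_def mult.commute)

lemma Re_cinner_commute: "Re (cinner y x) = Re (cinner x y)"
  by (subst cinner_commute) simp

lemma cinner_axis: "cinner (axis i 1) x = x $ i"
proof -
  have "cnj ((axis i 1 :: complex^'a) $ k) * x $ k = (if k = i then x $ k else 0)" for k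
    by (simp add: axis_def)
  then show ?thesis
    by (simp add: cinner_def)
qed

lemma cinner_self: "cinner x x = of_real ((norm x)\<^sup>2)"
  by (simp add: cinner_def norm_vec_def L2_set_def sum_nonneg complex_norm_square[symmetric] mult.commute[of "cnj _"])

lemma cinner_adjoint: "cinner x (M *v y) = cinner (ctransp M *v x) y"
  unfolding cinner_def matrix_vector_mult_def ctransp_def
  by (simp add: sum_distrib_left sum_distrib_right mult_ac) (rule sum.swap)

lemma quad_form_cinner: "quad_form M x = Re (cinner x (M *v x))"
  by (simp add: quad_form_def cinner_def)

lemma quad_form_simps:
  "quad_form (M + N) x = quad_form M x + quad_form N x"
  "quad_form (M - N) x = quad_form M x - quad_form N x"
  "quad_form (- M) x = - quad_form M x"
  "quad_form (c *\<^sub>R M) x = c * quad_form M x"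
  "quad_form 0 x = 0"
  "quad_form M 0 = 0"
  by (simp_all add: quad_form_def matrix_vector_mult_def algebra_simps sum.distrib sum_subtractf
      sum_negf sum_distrib_left)

lemma quad_form_mat1: "quad_form (mat 1) x = (norm x)\<^sup>2"
  by (simp add: quad_form_cinner cinner_self)

lemma quad_form_congruence: "quad_form (X ** M ** ctransp X) x = quad_form M (ctransp X *v x)"
  by (simp add: quad_form_cinner cinner_adjoint matrix_vector_mul_assoc[symmetric])

lemma quad_form_add:
  assumes "hermitian M"
  shows "quad_form M (x + y) = quad_form M x + quad_form M y + 2 * Re (cinner x (M *v y))"
proof -
  have "cinner y (M *v x) = cnj (cinner x (M *v y))"
    using assms by (simp add: cinner_adjoint[of y] hermitian_def cinner_commute[of "M *v y"])
  then show ?thesis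
    by (simp add: quad_form_cinner cinner_simps matrix_vector_right_distrib)
qed

text \<open>A crude entrywise estimate; the reciprocal of its constant becomes the radius in
  \<open>psd_near_mat1\<close>.\<close>

lemma abs_quad_form_le:
  fixes M :: "complex^'k^'k"
  shows "\<bar>quad_form M x\<bar> \<le> (real CARD('k))\<^sup>2 * norm M * (norm x)\<^sup>2"
proof -
  have "\<bar>quad_form M x\<bar> \<le> cmod (\<Sum>i\<in>UNIV. \<Sum>j\<in>UNIV. cnj (x $ i) * (M $ i $ j * x $ j))"
    unfolding quad_form_def matrix_vector_mult_def vec_lambda_beta sum_distrib_left
    by (rule abs_Re_le_cmod)
  also have "\<dots> \<le> (\<Sum>i\<in>(UNIV::'k set). \<Sum>j\<in>(UNIV::'k set). norm M * (norm x)\<^sup>2)"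
  proof (intro sum_norm_le)
    fix i j
    have "cmod (M $ i $ j) \<le> norm M"
      by (meson Finite_Cartesian_Product.norm_nth_le order_trans)
    then have "cmod (x $ i) * (cmod (M $ i $ j) * cmod (x $ j)) \<le> norm x * (norm M * norm x)"
      by (intro mult_mono Finite_Cartesian_Product.norm_nth_le) auto
    then show "cmod (cnj (x $ i) * (M $ i $ j * x $ j)) \<le> norm M * (norm x)\<^sup>2"
      by (simp add: norm_mult power2_eq_square mult_ac)
  qed
  finally show ?thesis
    by (simp add: power2_eq_square mult_ac)
qed

lemma hermitian_simps:
  "hermitian M \<Longrightarrow> hermitian N \<Longrightarrow> hermitian (M + N)"
  "hermitian M \<Longrightarrow> hermitian N \<Longrightarrow> hermitian (M - N)"
  "hermitian M \<Longrightarrow> hermitian (- M)"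
  "hermitian M \<Longrightarrow> hermitian (c *\<^sub>R M)"
  "hermitian 0" "hermitian (mat 1)"
  "hermitian M \<Longrightarrow> hermitian (X ** M ** ctransp X)"
  "hermitian (X ** ctransp X)"
  by (auto simp: hermitian_def ctransp_mult matrix_mul_assoc)

lemma hermitian_sum: "(\<And>i. i \<in> I \<Longrightarrow> hermitian (M i)) \<Longrightarrow> hermitian (\<Sum>i\<in>I. M i)"
  by (simp add: hermitian_def ctransp_sum)

section \<open>The semidefinite order on complex matrices\<close>

lemma psd_iff: "psd UNIV M \<longleftrightarrow> hermitian M \<and> (\<forall>x. 0 \<le> quad_form M x)"
  by (simp add: psd_def vec_over_def)

lemma pd_iff: "pd UNIV M \<longleftrightarrow> hermitian M \<and> (\<forall>x. x \<noteq> 0 \<longrightarrow> 0 < quad_form M x)"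
  by (simp add: pd_def vec_over_def)

lemma psd_add: "psd UNIV M \<Longrightarrow> psd UNIV N \<Longrightarrow> psd UNIV (M + N)"
  and psd_scaleR: "0 \<le> c \<Longrightarrow> psd UNIV M \<Longrightarrow> psd UNIV (c *\<^sub>R M)"
  and psd_0: "psd UNIV 0"
  and psd_congruence: "psd UNIV M \<Longrightarrow> psd UNIV (X ** M ** ctransp X)"
  by (simp_all add: psd_iff hermitian_simps quad_form_simps quad_form_congruence)

lemma psd_mult_ctransp: "psd UNIV (X ** ctransp X)"
proof -
  have "psd UNIV (mat 1)"
    by (simp add: psd_iff hermitian_simps quad_form_mat1)
  from psd_congruence[OF this, of X] show ?thesis
    by simp
qed

lemma psd_sum: "(\<And>i. i \<in> I \<Longrightarrow> psd UNIV (M i)) \<Longrightarrow> psd UNIV (\<Sum>i\<in>I. M i)"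
  by (induction I rule: infinite_finite_induct) (auto simp: psd_0 psd_add)

lemma psd_diff_trans: "psd UNIV (M - N) \<Longrightarrow> psd UNIV (N - K) \<Longrightarrow> psd UNIV (M - K)"
  using psd_add[of "M - N" "N - K"] by simp

lemma pd_imp_psd: "pd UNIV M \<Longrightarrow> psd UNIV M"
  by (metis order.refl order_less_imp_le pd_iff psd_iff quad_form_simps(6))

lemma pd_add_psd: "pd UNIV M \<Longrightarrow> psd UNIV N \<Longrightarrow> pd UNIV (M + N)"
  by (simp add: pd_iff psd_iff hermitian_simps quad_form_simps add_pos_nonneg)

lemma pd_scaleR: "0 < c \<Longrightarrow> pd UNIV M \<Longrightarrow> pd UNIV (c *\<^sub>R M)"
  by (simp add: pd_iff hermitian_simps quad_form_simps)

lemma closed_psd: "closed {M :: complex^'k^'k. psd UNIV M}"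
proof -
  have "{M :: complex^'k^'k. psd UNIV M} = {M. ctransp M = M} \<inter> (\<Inter>x. {M. 0 \<le> quad_form M x})"
    by (auto simp: psd_iff hermitian_def)
  moreover have "closed {M :: complex^'k^'k. ctransp M = M}"
    unfolding ctransp_def by (intro closed_Collect_eq continuous_intros)
  moreover have "closed {M :: complex^'k^'k. 0 \<le> quad_form M x}" for x
    unfolding quad_form_def matrix_vector_mult_def by (intro closed_Collect_le continuous_intros)
  ultimately show ?thesis
    by (simp only:) (intro closed_Int closed_INT ballI; assumption)
qed

text \<open>Shows that the identity is interior to the semidefinite cone relative to the Hermitian
  matrices, as the resolvent argument requires of its point \<open>e\<close>.\<close>

lemma psd_near_mat1:
  fixes M :: "complex^'k^'k"
  assumes "hermitian M" and "norm (M - mat 1) < 1 / (real CARD('k))\<^sup>2"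
  shows "psd UNIV M"
  unfolding psd_iff
proof (intro conjI allI)
  fix x
  have "(real CARD('k))\<^sup>2 * norm (M - mat 1) \<le> 1"
    using assms(2) by (simp add: field_simps)
  then have "\<bar>quad_form (M - mat 1) x\<bar> \<le> 1 * (norm x)\<^sup>2"
    by (intro order_trans[OF abs_quad_form_le] mult_right_mono) auto
  then show "0 \<le> quad_form M x"
    by (simp add: quad_form_simps quad_form_mat1)
qed fact

lemma quad_form_axis: "quad_form M (axis i 1) = Re (M $ i $ i)"
proof -
  have "(M *v axis i 1) $ i = M $ i $ i"
    by (simp add: matrix_vector_mult_def axis_def if_distrib cong: if_cong)
  then show ?thesis
    by (simp add: quad_form_cinner cinner_axis)
qed

lemma psd_diag: "psd UNIV M \<Longrightarrow> 0 \<le> Re (M $ i $ i)"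
  by (metis psd_iff quad_form_axis)

lemma psd_trace_nonneg: "psd UNIV M \<Longrightarrow> 0 \<le> Re (trace M)"
  by (simp add: trace_def sum_nonneg psd_diag)

text \<open>Off the diagonal, the form is tested on \<open>axis i 1 + u *s axis j 1\<close> with a
  phase \<open>u\<close> that turns the cross term into \<open>- 2 * cmod a\<close>; so twice the
  modulus is at most the sum of two diagonal entries.\<close>

lemma psd_entry_le_trace:
  assumes M: "psd UNIV M"
  shows "cmod (M $ i $ j) \<le> Re (trace M)"
proof (cases "i = j")
  case True
  have "ctransp M $ i $ i = M $ i $ i"
    using M by (simp add: psd_iff hermitian_def)
  then have "cmod (M $ i $ i) = Re (M $ i $ i)"
    using psd_diag[OF M, of i] by (simp add: ctransp_def complex_eq_iff cmod_def)
  also have "\<dots> \<le> Re (trace M)"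
    unfolding trace_def Re_sum by (rule member_le_sum) (auto simp: psd_diag[OF M])
  finally show ?thesis
    using True by simp
next
  case False
  define a where "a = M $ i $ j"
  \<comment> \<open>The phase that rotates \<open>a\<close> onto the negative real axis. The value 0
    for \<open>a = 0\<close> is harmless, because only \<open>cmod u \<le> 1\<close> and
    \<open>Re (u * a) = - cmod a\<close> are used.\<close>
  define u where "u = (if a = 0 then 0 else - cnj a / cmod a)"
  have nu: "cmod u \<le> 1"
    by (simp add: u_def norm_divide)
  have ua: "Re (u * a) = - cmod a"
  proof (cases "a = 0")
    case False
    have "u * a = - of_real ((cmod a)\<^sup>2) / of_real (cmod a)"
      using False by (simp add: u_def complex_norm_square[symmetric] mult.commute[of "cnj a"])
    also have "\<dots> = of_real (- cmod a)"
      using False by (simp add: power2_eq_square)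
    finally show ?thesis
      by (metis Re_complex_of_real)
  qed (simp add: u_def)
  have 1: "(M *v (u *s axis j 1)) $ i = u * a"
    by (simp add: a_def matrix_vector_mult_def axis_def if_distrib mult.commute cong: if_cong)
  have 2: "quad_form M (u *s axis j 1) = (cmod u)\<^sup>2 * Re (M $ j $ j)"
  proof -
    have "cinner (u *s axis j 1) (M *v (u *s axis j 1)) = (cnj u * u) * cinner (axis j 1) (M *v axis j 1)"
      by (simp add: cinner_simps vector_scalar_commute)
    also have "cnj u * u = of_real ((cmod u)\<^sup>2)"
      by (simp add: complex_norm_square[symmetric] mult.commute[of "cnj u"])
    finally show ?thesis
      by (simp only: quad_form_cinner Re_complex_of_real quad_form_axis[of M j, unfolded quad_form_cinner, symmetric]) simp
  qed
  have "0 \<le> quad_form M (axis i 1 + u *s axis j 1)"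
    using M by (simp add: psd_iff)
  also have "\<dots> = Re (M $ i $ i) + (cmod u)\<^sup>2 * Re (M $ j $ j) - 2 * cmod a"
    using M ua by (simp add: psd_iff quad_form_add quad_form_axis 2 cinner_axis 1)
  also have "(cmod u)\<^sup>2 * Re (M $ j $ j) \<le> 1 * Re (M $ j $ j)"
    using nu psd_diag[OF M] by (intro mult_right_mono) (auto simp: power_le_one)
  finally have "2 * cmod a \<le> (\<Sum>k\<in>{i, j}. Re (M $ k $ k))"
    using False by simp
  also have "\<dots> \<le> Re (trace M)"
    unfolding trace_def Re_sum by (rule sum_mono2) (auto simp: psd_diag[OF M])
  finally show ?thesis
    using psd_trace_nonneg[OF M] by (simp add: a_def)
qed

lemma psd_trace_eq_0: "psd UNIV M \<Longrightarrow> Re (trace M) \<le> 0 \<Longrightarrow> M = 0"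
  using psd_entry_le_trace[of M] by (simp add: vec_eq_iff) (metis order_trans norm_le_zero_iff)

section \<open>Inverses and Schur complements\<close>

lemma pd_invertible: "pd UNIV M \<Longrightarrow> invertible M"
proof -
  assume M: "pd UNIV M"
  have "x = 0" if "M *v x = 0" for x
    using M that by (auto simp: pd_iff quad_form_cinner cinner_simps)
  then show ?thesis
    by (simp add: invertible_left_inverse matrix_left_invertible_ker)
qed

lemma matrix_inv:
  fixes M :: "complex^'k^'k"
  assumes "invertible M"
  shows matrix_inv_right: "M ** matrix_inv M = mat 1" and matrix_inv_left: "matrix_inv M ** M = mat 1"
proof -
  have "\<exists>B. M ** B = mat 1 \<and> B ** M = mat 1"
    using assms by (simp add: invertible_def)
  from someI_ex[OF this] show "M ** matrix_inv M = mat 1" "matrix_inv M ** M = mat 1"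
    by (simp_all add: matrix_inv_def)
qed

lemma matrix_inv_unique:
  fixes M :: "complex^'k^'k"
  assumes "invertible M" "B ** M = mat 1"
  shows "B = matrix_inv M"
  by (metis assms matrix_inv_right matrix_mul_assoc matrix_mul_lid matrix_mul_rid)

lemma hermitian_matrix_inv:
  assumes "hermitian M" "invertible M"
  shows "ctransp (matrix_inv M) = matrix_inv M"
proof (rule matrix_inv_unique[OF assms(2)])
  have "ctransp (M ** matrix_inv M) = mat 1"
    using assms by (simp add: matrix_inv_right)
  then show "ctransp (matrix_inv M) ** M = mat 1"
    using assms(1) by (simp add: ctransp_mult hermitian_def)
qed

lemma continuous_on_det [continuous_intros]:
  fixes f :: "'a::topological_space \<Rightarrow> complex^'k^'k"
  assumes "\<And>i j. continuous_on S (\<lambda>x. f x $ i $ j)"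
  shows "continuous_on S (\<lambda>x. det (f x))"
  unfolding det_def by (intro continuous_intros assms)

text \<open>By Cramer's rule each entry of the inverse is a quotient of determinants, with
  nonvanishing denominator on \<open>S\<close>.\<close>

lemma continuous_on_matrix_inv:
  fixes f :: "'a::topological_space \<Rightarrow> complex^'k^'k"
  assumes f: "continuous_on S f" and inv: "\<And>s. s \<in> S \<Longrightarrow> invertible (f s)"
  shows "continuous_on S (\<lambda>s. matrix_inv (f s))"
proof -
  define g where "g s = (\<chi> k l. det (\<chi> i j. if j = k then axis l 1 $ i else f s $ i $ j) / det (f s))" for s
  have "matrix_inv (f s) = g s" if s: "s \<in> S" for s
  proof -
    have "matrix_inv (f s) $ k $ l = g s $ k $ l" for k l
    proof -
      let ?x = "matrix_inv (f s) *v axis l 1"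
      have "f s *v ?x = axis l 1"
        using inv[OF s] by (simp add: matrix_vector_mul_assoc matrix_inv_right)
      moreover have "det (f s) \<noteq> 0"
        using inv[OF s] by (simp add: invertible_det_nz)
      ultimately have "?x = (\<chi> k. det (\<chi> i j. if j = k then axis l 1 $ i else f s $ i $ j) / det (f s))"
        using cramer by blast
      then have "?x $ k = g s $ k $ l"
        by (simp add: g_def)
      moreover have "?x $ k = matrix_inv (f s) $ k $ l"
        by (simp add: matrix_vector_mult_def axis_def if_distrib cong: if_cong)
      ultimately show ?thesis
        by simp
    qed
    then show ?thesis
      by (simp add: vec_eq_iff)
  qed
  moreover have "continuous_on S g"
    unfolding g_def
  proof (intro continuous_on_vec_lambda continuous_on_divide continuous_on_det)
    show "\<forall>s\<in>S. det (f s) \<noteq> 0"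
      using inv by (simp add: invertible_det_nz)
    show "continuous_on S (\<lambda>x. (\<chi> i j. if j = k then axis l 1 $ i else f x $ i $ j) $ i $ j)" for k l i j
      using f by (cases "j = k") (auto intro!: continuous_on_component)
    show "continuous_on S (\<lambda>x. f x $ i $ j)" for i j
      using f by (intro continuous_on_component)
  qed
  ultimately show ?thesis
    by (simp cong: continuous_on_cong)
qed

lemma quad_form_block_mat:
  "quad_form (block_mat N C (ctransp C) R) z =
     quad_form N (\<chi> a. z $ Inl a) + quad_form R (\<chi> b. z $ Inr b)
     + 2 * Re (cinner (\<chi> a. z $ Inl a) (C *v (\<chi> b. z $ Inr b)))"
proof -
  let ?x = "\<chi> a. z $ Inl a" and ?y = "\<chi> b. z $ Inr b" and ?B = "block_mat N C (ctransp C) R"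
  have split: "sum h (UNIV :: ('a + 'b) set) = (\<Sum>a\<in>UNIV. h (Inl a)) + (\<Sum>b\<in>UNIV. h (Inr b))"
    for h :: "'a + 'b \<Rightarrow> complex"
    by (subst UNIV_Plus_UNIV[symmetric]) (simp only: sum.Plus finite o_def)
  have 1: "(?B *v z) $ Inl a = (N *v ?x) $ a + (C *v ?y) $ a" for a
    by (simp add: matrix_vector_mult_def split block_mat_def)
  have 2: "(?B *v z) $ Inr b = (ctransp C *v ?x) $ b + (R *v ?y) $ b" for b
    by (simp add: matrix_vector_mult_def split block_mat_def)
  have "cinner z (?B *v z) = cinner ?x (N *v ?x) + cinner ?x (C *v ?y)
      + (cinner ?y (ctransp C *v ?x) + cinner ?y (R *v ?y))"
    by (simp add: cinner_def[of z] split 1 2) (simp add: cinner_def algebra_simps sum.distrib)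
  moreover have "cinner ?y (ctransp C *v ?x) = cnj (cinner ?x (C *v ?y))"
    by (simp add: cinner_adjoint[of ?y] cinner_commute[of "C *v ?y"])
  ultimately show ?thesis
    by (simp add: quad_form_cinner)
qed

lemma hermitian_block_mat:
  assumes "hermitian N" "hermitian R"
  shows "hermitian (block_mat N C (ctransp C) R)"
proof -
  have "cnj (N $ j $ i) = N $ i $ j" for i j
    using assms(1) unfolding hermitian_def ctransp_def by (metis vec_lambda_beta)
  moreover have "cnj (R $ j $ i) = R $ i $ j" for i j
    using assms(2) unfolding hermitian_def ctransp_def by (metis vec_lambda_beta)
  ultimately show ?thesis
    by (auto simp: hermitian_def ctransp_def block_mat_def vec_eq_iff split: sum.split)
qed

text \<open>With \<open>k x = matrix_inv R *v (ctransp C *v x)\<close>, the block form at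
  \<open>(x, y)\<close> is the Schur form at \<open>x\<close> plus the form of \<open>R\<close> at
  \<open>y + k x\<close>. The second term is nonnegative and vanishes at
  \<open>y = - k x\<close>.\<close>

lemma schur_complement:
  fixes N :: "complex^'k^'k" and R :: "complex^'l^'l"
  assumes N: "hermitian N" and R: "pd UNIV R"
  shows "psd UNIV (block_mat N C (ctransp C) R) \<longleftrightarrow> psd UNIV (N - C ** matrix_inv R ** ctransp C)"
proof -
  let ?S = "N - C ** matrix_inv R ** ctransp C"
  have hR: "hermitian R" and iR: "invertible R"
    using R pd_invertible by (auto simp: pd_iff)
  have hI: "ctransp (matrix_inv R) = matrix_inv R"
    by (rule hermitian_matrix_inv[OF hR iR])
  define k where "k x = matrix_inv R *v (ctransp C *v x)" for x
  have Rk: "R *v k x = ctransp C *v x" for x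
    by (simp add: k_def matrix_vector_mul_assoc matrix_inv_right[OF iR] matrix_mul_assoc)
  have square: "quad_form (block_mat N C (ctransp C) R) z
      = quad_form ?S x + quad_form R (y + k x)"
    if "x = (\<chi> a. z $ Inl a)" "y = (\<chi> b. z $ Inr b)" for x y z
  proof -
    have "quad_form (C ** matrix_inv R ** ctransp C) x = Re (cinner x (C *v k x))"
      by (simp add: quad_form_cinner k_def matrix_vector_mul_assoc matrix_mul_assoc)
    moreover have "quad_form R (k x) = Re (cinner x (C *v k x))"
      by (simp add: quad_form_cinner Rk cinner_adjoint[of "k x"]) (rule Re_cinner_commute)
    moreover have "Re (cinner y (R *v k x)) = Re (cinner x (C *v y))"
      by (simp add: Rk cinner_adjoint[of y]) (rule Re_cinner_commute)
    ultimately show ?thesis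
      by (simp add: quad_form_block_mat that[symmetric] quad_form_simps quad_form_add[OF hR])
  qed
  have herm: "hermitian ?S"
    using N hI by (simp add: hermitian_def ctransp_mult matrix_mul_assoc)
  show ?thesis
  proof
    assume *: "psd UNIV (block_mat N C (ctransp C) R)"
    have "0 \<le> quad_form ?S x" for x
    proof -
      define z where "z = (\<chi> i. case i of Inl a \<Rightarrow> x $ a | Inr b \<Rightarrow> - k x $ b)"
      have "quad_form (block_mat N C (ctransp C) R) z = quad_form ?S x + quad_form R (- k x + k x)"
        by (rule square) (simp_all add: z_def vec_eq_iff)
      moreover have "0 \<le> quad_form (block_mat N C (ctransp C) R) z"
        using * by (simp add: psd_iff)
      ultimately show ?thesis
        by (simp add: quad_form_simps)
    qed
    then show "psd UNIV ?S"
      using herm by (simp add: psd_iff)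
  next
    assume "psd UNIV ?S"
    then have "0 \<le> quad_form (block_mat N C (ctransp C) R) z" for z
      using pd_imp_psd[OF R] by (simp only: square[OF refl refl]) (simp add: psd_iff)
    then show "psd UNIV (block_mat N C (ctransp C) R)"
      using hermitian_block_mat[OF N hR] by (simp add: psd_iff)
  qed
qed

section \<open>Matrices over the scalar field\<close>

text \<open>For real \<open>M\<close> the cross terms between real and imaginary parts of
  \<open>x\<close> are purely imaginary, so the real part drops them. This is what identifies the
  orders over \<open>\<real>\<close> and over \<open>UNIV\<close>.\<close>

lemma quad_form_real_split:
  assumes "mat_over \<real> M"
  shows "quad_form M x = quad_form M (\<chi> i. of_real (Re (x $ i))) + quad_form M (\<chi> i. of_real (Im (x $ i)))"
proof -
  have im: "Im (M $ i $ j) = 0" for i j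
    using assms by (auto simp: mat_over_def complex_is_Real_iff)
  show ?thesis
    by (simp add: quad_form_def matrix_vector_mult_def im sum_distrib_left
        sum.distrib[symmetric] algebra_simps)
qed

lemma vec_over_real_parts:
  "vec_over \<real> (\<chi> i. of_real (Re (x $ i)))" "vec_over \<real> (\<chi> i. of_real (Im (x $ i)))"
  by (simp_all add: vec_over_def)

lemma psd_over_UNIV:
  assumes F: "F = \<real> \<or> F = UNIV" and M: "mat_over F M"
  shows "psd F M \<longleftrightarrow> psd UNIV M"
proof (cases "F = UNIV")
  case False
  then have F: "F = \<real>"
    using F by simp
  have "0 \<le> quad_form M x" if "psd F M" for x
    using that M F vec_over_real_parts[of x]
    by (subst quad_form_real_split) (auto simp: psd_def)
  then show ?thesis
    by (auto simp: psd_iff) (auto simp: psd_def)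
qed simp

lemma pd_over_UNIV:
  assumes F: "F = \<real> \<or> F = UNIV" and M: "mat_over F M"
  shows "pd F M \<longleftrightarrow> pd UNIV M"
proof (cases "F = UNIV")
  case False
  then have F: "F = \<real>"
    using F by simp
  show ?thesis
  proof
    assume pd: "pd F M"
    have "0 < quad_form M x" if "x \<noteq> 0" for x
    proof -
      let ?a = "\<chi> i. complex_of_real (Re (x $ i))" and ?b = "\<chi> i. complex_of_real (Im (x $ i))"
      have "?a \<noteq> 0 \<or> ?b \<noteq> 0"
        using that by (auto simp: vec_eq_iff complex_eq_iff)
      moreover have "?a \<noteq> 0 \<longrightarrow> 0 < quad_form M ?a" "?b \<noteq> 0 \<longrightarrow> 0 < quad_form M ?b"
        using pd F vec_over_real_parts[of x] by (auto simp: pd_def)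
      ultimately have "0 < quad_form M ?a + quad_form M ?b"
        by (metis add_pos_pos add.left_neutral add.right_neutral quad_form_simps(6))
      then show ?thesis
        using quad_form_real_split[of M x] M F by simp
    qed
    then show "pd UNIV M"
      using pd by (simp add: pd_iff pd_def)
  qed (auto simp: pd_def vec_over_def)
qed simp

lemma mat_over_closure:
  assumes F: "F = \<real> \<or> F = UNIV"
  shows "mat_over F X \<Longrightarrow> mat_over F Y \<Longrightarrow> mat_over F (X + Y)"
    "mat_over F X \<Longrightarrow> mat_over F Y \<Longrightarrow> mat_over F (X - Y)"
    "mat_over F X \<Longrightarrow> mat_over F (- X)"
    "mat_over F X \<Longrightarrow> mat_over F (c *\<^sub>R X)"
    "mat_over F X \<Longrightarrow> mat_over F (ctransp X)"
    "mat_over F U \<Longrightarrow> mat_over F V \<Longrightarrow> mat_over F (U ** V)"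
    "mat_over F 0" "mat_over F (mat 1)"
  using F by (auto simp: mat_over_def ctransp_def matrix_matrix_mult_def mat_def Reals_cnj_iff
      scaleR_conv_of_real[where 'a=complex])

lemma mat_over_sum:
  assumes F: "F = \<real> \<or> F = UNIV"
  shows "(\<And>i. i \<in> I \<Longrightarrow> mat_over F (X i)) \<Longrightarrow> mat_over F (\<Sum>i\<in>I. X i)"
  using F by (auto simp: mat_over_def)

text \<open>Entrywise conjugation fixes a real \<open>M\<close>, hence sends its inverse to another
  left inverse; by uniqueness the inverse is real.\<close>

lemma mat_over_matrix_inv:
  fixes M :: "complex^'k^'k"
  assumes F: "F = \<real> \<or> F = UNIV" and M: "mat_over F M" "invertible M"
  shows "mat_over F (matrix_inv M)"
proof (cases "F = UNIV")
  case True
  then show ?thesis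
    by (simp add: mat_over_def)
next
  case False
  define conj where "conj X = (\<chi> i j. cnj (X $ i $ j))" for X :: "complex^'k^'k"
  have "conj (matrix_inv M) ** conj M = conj (matrix_inv M ** M)"
    by (simp add: conj_def matrix_matrix_mult_def vec_eq_iff)
  moreover have "conj M = M"
    using F M False by (auto simp: mat_over_def conj_def vec_eq_iff Reals_cnj_iff)
  moreover have "conj (mat 1) = mat 1"
    by (auto simp: conj_def mat_def vec_eq_iff)
  ultimately have "conj (matrix_inv M) = matrix_inv M"
    using M by (intro matrix_inv_unique) (auto simp: matrix_inv_left)
  then have "mat_over \<real> (matrix_inv M)"
    by (auto simp: mat_over_def conj_def vec_eq_iff Reals_cnj_iff)
  then show ?thesis
    using F False by auto
qed

lemma mat_over_block_mat:
  "mat_over F N \<Longrightarrow> mat_over F C \<Longrightarrow> mat_over F C' \<Longrightarrow> mat_over F R \<Longrightarrow> mat_over F (block_mat N C C' R)"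
  by (auto simp: mat_over_def block_mat_def split: sum.split)

section \<open>The Riccati operator\<close>

lemma D_op_simps:
  "D_op Q (Y + Z) n = D_op Q Y n + D_op Q Z n" "D_op Q (Y - Z) n = D_op Q Y n - D_op Q Z n"
  "D_op Q (c *\<^sub>R Y) n = c *\<^sub>R D_op Q Y n" "D_op Q 0 n = 0"
  by (simp_all add: D_op_def scaleR_right_distrib scaleR_right_diff_distrib sum.distrib
      sum_subtractf scaleR_sum_right mult.commute)

lemma linear_V_op: "linear (V_op A L Q \<gamma> K)"
  by (rule linearI; rule vec_eq_iff[THEN iffD2]; rule allI)
    (simp_all add: V_op_def D_op_simps matrix_add_ldistrib mmul_simps
      scaleR_right_distrib mult.commute)

lemma mult_scaled_matrix:
  fixes X :: "complex^'b^'a" and Y :: "complex^'c^'b"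
  shows "X ** (\<chi> i j. c * Y $ i $ j) = (\<chi> i j. c * (X ** Y) $ i $ j)"
    "(\<chi> i j. c * X $ i $ j) ** Y = (\<chi> i j. c * (X ** Y) $ i $ j)"
  by (simp_all add: matrix_matrix_mult_def vec_eq_iff sum_distrib_left mult_ac)

text \<open>Together with \<open>linear_V_op\<close> this is complex linearity, in the form the
  eigenvalue lemmas ask for.\<close>

lemma V_op_complex_scale:
  "V_op A L Q \<gamma> K (complex_scale c S) = complex_scale c (V_op A L Q \<gamma> K S)"
proof -
  have "D_op Q (complex_scale c S) n = (\<chi> i j. c * D_op Q S n $ i $ j)" for n
    by (simp add: D_op_def complex_scale_def vec_eq_iff sum_distrib_left)
  then show ?thesis
    by (simp add: V_op_def mult_scaled_matrix) (simp add: complex_scale_def vec_eq_iff algebra_simps)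
qed

lemma continuous_on_matrix_mult:
  fixes f :: "'t::topological_space \<Rightarrow> complex^'b^'a" and g :: "'t \<Rightarrow> complex^'c^'b"
  assumes "continuous_on S f" "continuous_on S g"
  shows "continuous_on S (\<lambda>t. f t ** g t)"
  unfolding matrix_matrix_mult_def by (intro continuous_intros assms)

lemma continuous_on_ctransp:
  assumes "continuous_on S f"
  shows "continuous_on S (\<lambda>t. ctransp (f t))"
  unfolding ctransp_def by (intro continuous_intros assms)

lemma continuous_on_D_op: "continuous_on S (\<lambda>Y. D_op Q Y n)"
  unfolding D_op_def by (intro continuous_intros)

section \<open>The trace on ordered tuples\<close>

lemma trace_objective_sum: "trace_objective Y = (\<Sum>n\<in>UNIV. Re (trace (Y $ n)))"
  unfolding trace_objective_def trace_def by simp (rule sum.swap)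

lemma tuple_psd_trace_mono:
  assumes "\<And>n. psd UNIV (Y $ n - Z $ n)"
  shows "trace_objective Z \<le> trace_objective Y"
  unfolding trace_objective_sum
proof (rule sum_mono)
  show "Re (trace (Z $ n)) \<le> Re (trace (Y $ n))" for n
    using psd_trace_nonneg[OF assms, of n] by (simp add: trace_def sum_subtractf)
qed

text \<open>Strictness of the trace on comparable tuples: nonnegative traces with a nonpositive sum
  all vanish. It turns trace minimality into a fixed point and trace maximality into
  uniqueness.\<close>

lemma tuple_psd_trace_eq:
  assumes psd: "\<And>n. psd UNIV (Y $ n - Z $ n)" and le: "trace_objective Y \<le> trace_objective Z"
  shows "Y = Z"
proof -
  have nonneg: "0 \<le> Re (trace (Y $ n - Z $ n))" for n
    by (rule psd_trace_nonneg[OF psd])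
  have "(\<Sum>n\<in>UNIV. Re (trace (Y $ n - Z $ n))) = trace_objective Y - trace_objective Z"
    by (simp add: trace_objective_sum trace_def sum_subtractf)
  then have "(\<Sum>n\<in>UNIV. Re (trace (Y $ n - Z $ n))) = 0"
    using le sum_nonneg[of UNIV "\<lambda>n. Re (trace (Y $ n - Z $ n))"] nonneg by simp
  then have "Re (trace (Y $ n - Z $ n)) = 0" for n
    using nonneg by (simp add: sum_nonneg_eq_0_iff)
  then have "Y $ n - Z $ n = 0" for n
    by (intro psd_trace_eq_0 psd) simp
  then show ?thesis
    by (simp add: vec_eq_iff[where x=Y])
qed

lemma norm_vec_le_sum: "norm x \<le> (\<Sum>i\<in>UNIV. norm (x $ i))"
  unfolding norm_vec_def by (rule L2_set_le_sum) simp

lemma tuple_psd_norm_le: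
  fixes Y :: "complex^'x^'x^'i"
  assumes psd: "\<And>n. psd UNIV (Y $ n)"
  shows "norm Y \<le> real CARD('i) * real CARD('x) * real CARD('x) * trace_objective Y"
proof -
  have 1: "cmod (Y $ n $ i $ j) \<le> trace_objective Y" for n i j
  proof -
    have "cmod (Y $ n $ i $ j) \<le> Re (trace (Y $ n))"
      by (rule psd_entry_le_trace[OF psd])
    also have "\<dots> \<le> trace_objective Y"
      unfolding trace_objective_sum by (rule member_le_sum) (auto simp: psd_trace_nonneg[OF psd])
    finally show ?thesis .
  qed
  have "norm Y \<le> (\<Sum>n\<in>UNIV. \<Sum>i\<in>UNIV. \<Sum>j\<in>UNIV. norm (Y $ n $ i $ j))"
    by (intro norm_vec_le_sum order_trans[OF norm_vec_le_sum] sum_mono)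
  also have "\<dots> \<le> (\<Sum>n\<in>(UNIV::'i set). \<Sum>i\<in>(UNIV::'x set). \<Sum>j\<in>(UNIV::'x set). trace_objective Y)"
    by (intro sum_mono 1)
  finally show ?thesis
    by (simp add: mult.assoc)
qed

text \<open>Some state \<open>m\<close> carries mass, and irreducibility provides \<open>k\<close>
  with a positive \<open>k\<close>-step probability from \<open>m\<close> to \<open>n\<close>;
  invariance under the \<open>k\<close>-th power moves mass to \<open>n\<close>. Strict positivity
  is what makes the noise term of \<open>R_op\<close> positive definite in every mode.\<close>

lemma stationary_distribution_pos:
  fixes Q :: "real^'i^'i"
  assumes Q: "ergodic_chain Q" and \<pi>: "stationary_distribution Q \<pi>"
  shows "0 < \<pi> $ n"
proof -
  have nonneg: "0 \<le> \<pi> $ m" for m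
    using \<pi> by (simp add: stationary_distribution_def)
  have pow: "\<pi> v* mat_pow Q k = \<pi> \<and> (\<forall>i j. 0 \<le> mat_pow Q k $ i $ j)" for k
  proof (induction k)
    case (Suc k)
    have "mat_pow Q (Suc k) = Q ** mat_pow Q k"
      by (simp add: mat_pow_def)
    moreover have "\<pi> v* Q = \<pi>" "\<And>i j. 0 \<le> Q $ i $ j"
      using Q \<pi> by (auto simp: stationary_distribution_def ergodic_chain_def stochastic_matrix_def)
    ultimately show ?case
      using Suc by (auto simp: vector_matrix_mul_assoc[symmetric])
        (auto simp: matrix_matrix_mult_def intro!: sum_nonneg)
  next
    case 0
    have "mat_pow Q 0 = mat 1"
      by (simp add: mat_pow_def)
    then show ?case
      by simp (simp add: mat_def)
  qed
  have "\<exists>m. \<pi> $ m \<noteq> 0"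
  proof (rule ccontr)
    assume "\<nexists>m. \<pi> $ m \<noteq> 0"
    then have "(\<Sum>n\<in>UNIV. \<pi> $ n) = 0"
      by simp
    then show False
      using \<pi> by (simp add: stationary_distribution_def)
  qed
  then obtain m where m: "0 < \<pi> $ m"
    using nonneg by (metis order_less_le)
  obtain k where k: "0 < mat_pow Q k $ m $ n"
    using Q by (auto simp: ergodic_chain_def irreducible_chain_def)
  have "0 < mat_pow Q k $ m $ n * \<pi> $ m"
    using m k by simp
  also have "\<dots> \<le> (\<Sum>i\<in>UNIV. mat_pow Q k $ i $ n * \<pi> $ i)"
    by (rule member_le_sum) (use nonneg pow in auto)
  also have "\<dots> = (\<pi> v* mat_pow Q k) $ n"
    by (simp add: vector_matrix_mult_def mult.commute)
  also have "\<dots> = \<pi> $ n"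
    using pow by simp
  finally show ?thesis .
qed

lemma subspace_hermitian_tuples:
  assumes "F = \<real> \<or> F = UNIV"
  shows "subspace (hermitian_tuples F)"
  by (simp add: subspace_def hermitian_tuples_def mat_over_closure[OF assms] hermitian_simps)

section \<open>Standing assumptions and the feasible set\<close>

locale filtering =
  fixes F :: "complex set"
    and A :: "complex^'x^'x" and L :: "complex^'x^'y"
    and G :: "complex^'w^'x" and H :: "complex^'w^'y"
    and Q :: "real^'i^'i" and \<pi> :: "real^'i" and \<gamma> :: "real^'i"
  assumes F: "F = \<real> \<or> F = UNIV"
    and over: "mat_over F A" "mat_over F L" "mat_over F G" "mat_over F H"
    and HH: "pd F (H ** ctransp H)"
    and Q_nonneg: "\<And>m n. 0 \<le> Q $ m $ n"
    and \<pi>_pos: "\<And>n. 0 < \<pi> $ n"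
    and \<gamma>_nonneg: "\<And>n. 0 \<le> \<gamma> $ n" and \<gamma>_le_1: "\<And>n. \<gamma> $ n \<le> 1"
begin

abbreviation "HF \<equiv> hermitian_tuples F :: (complex^'x^'x^'i) set"
abbreviation "D \<equiv> D_op Q :: complex^'x^'x^'i \<Rightarrow> 'i \<Rightarrow> complex^'x^'x"
abbreviation "R \<equiv> R_op L H Q \<pi>"
abbreviation "Ric \<equiv> Y_op A L G H Q \<pi> \<gamma>"
abbreviation "MM \<equiv> M_set F A L G H Q \<pi> \<gamma>"

text \<open>The cone for \<open>positive_resolvent\<close>: test vectors are complex, while
  membership in \<open>HF\<close> keeps the entries in \<open>F\<close>.\<close>

definition "nonneg_tuples = {Y \<in> HF. \<forall>n. psd UNIV (Y $ n)}"

lemmas overs = mat_over_closure[OF F] over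

lemma HF_hermitian: "Y \<in> HF \<Longrightarrow> hermitian (Y $ n)"
  and HF_over: "Y \<in> HF \<Longrightarrow> mat_over F (Y $ n)"
  by (auto simp: hermitian_tuples_def)

lemma D_hermitian: "Y \<in> HF \<Longrightarrow> hermitian (D Y n)"
  and D_over: "Y \<in> HF \<Longrightarrow> mat_over F (D Y n)"
  unfolding D_op_def
  by (auto intro!: hermitian_sum hermitian_simps mat_over_sum[OF F] overs HF_hermitian HF_over)

lemma D_psd: "(\<And>n. psd UNIV (Y $ n)) \<Longrightarrow> psd UNIV (D Y n)"
  unfolding D_op_def by (intro psd_sum psd_scaleR Q_nonneg)

lemma R_hermitian: "Y \<in> HF \<Longrightarrow> hermitian (R Y n)"
  and R_over: "Y \<in> HF \<Longrightarrow> mat_over F (R Y n)"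
  unfolding R_op_def by (auto intro!: hermitian_simps overs D_hermitian D_over)

lemma R_pd_iff: "Y \<in> HF \<Longrightarrow> pd F (R Y n) \<longleftrightarrow> pd UNIV (R Y n)"
  by (rule pd_over_UNIV[OF F R_over])

lemma R_pd:
  assumes "Y \<in> nonneg_tuples"
  shows "pd UNIV (R Y n)"
proof -
  have "mat_over F (H ** ctransp H)"
    by (intro overs)
  then have "pd UNIV (H ** ctransp H)"
    using HH by (simp add: pd_over_UNIV[OF F])
  then show ?thesis
    unfolding R_op_def using assms
    by (intro pd_add_psd pd_scaleR \<pi>_pos psd_congruence D_psd) (auto simp: nonneg_tuples_def)
qed

lemma A_op_HF: "Y \<in> HF \<Longrightarrow> hermitian (A_op A G Q \<pi> Y n)" "Y \<in> HF \<Longrightarrow> mat_over F (A_op A G Q \<pi> Y n)"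
  unfolding A_op_def by (auto intro!: hermitian_simps overs D_hermitian D_over)

lemma C_op_over: "Y \<in> HF \<Longrightarrow> mat_over F (C_op A L Q \<gamma> Y n)"
  unfolding C_op_def by (auto intro!: overs D_over)

lemma Ric_HF:
  assumes Y: "Y \<in> HF" and inv: "\<And>n. invertible (R Y n)"
  shows "Ric Y \<in> HF"
proof -
  have "mat_over F (Ric Y $ n)" for n
    unfolding Y_op_def using Y inv
    by (auto intro!: overs A_op_HF C_op_over mat_over_matrix_inv[OF F] R_over)
  moreover have "hermitian (matrix_inv (R Y n))" for n
    using hermitian_matrix_inv[OF R_hermitian[OF Y] inv] by (simp add: hermitian_def)
  then have "hermitian (Ric Y $ n)" for n
    unfolding Y_op_def using Y by (auto intro!: hermitian_simps A_op_HF)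
  ultimately show ?thesis
    by (simp add: hermitian_tuples_def)
qed

text \<open>Moves the definition to the complex order. Positive definiteness of \<open>R Y n\<close>
  gives invertibility, which in turn keeps the entries of \<open>Ric Y\<close> in
  \<open>F\<close>.\<close>

lemma M_set_iff:
  "Y \<in> MM \<longleftrightarrow> Y \<in> HF \<and> (\<forall>n. pd UNIV (R Y n)) \<and> (\<forall>n. psd UNIV (Ric Y $ n - Y $ n))"
proof -
  have "psd F (Ric Y $ n - Y $ n) \<longleftrightarrow> psd UNIV (Ric Y $ n - Y $ n)"
    if "Y \<in> HF" "\<forall>n. pd UNIV (R Y n)" for n
    using that by (intro psd_over_UNIV[OF F] overs HF_over Ric_HF pd_invertible) auto
  moreover have "tuple_ge F (- Y + Ric Y) 0 \<longleftrightarrow> (\<forall>n. psd F (Ric Y $ n - Y $ n))"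
    by (simp add: tuple_ge_def)
  ultimately show ?thesis
    unfolding M_set_def L_set_def using R_pd_iff by (auto intro: pd_invertible)
qed

lemma M_set_HF: "Y \<in> MM \<Longrightarrow> Y \<in> HF"
  by (simp add: M_set_iff)

lemma tuple_ge_iff: "Y \<in> HF \<Longrightarrow> Z \<in> HF \<Longrightarrow> tuple_ge F Y Z \<longleftrightarrow> (\<forall>n. psd UNIV (Y $ n - Z $ n))"
  unfolding tuple_ge_def by (simp add: psd_over_UNIV[OF F overs(2)[OF HF_over HF_over]])

lemma LMI_feasible_eq_M_set: "LMI_feasible F A L G H Q \<pi> \<gamma> = MM"
proof (rule set_eqI)
  fix Y
  have "psd F (block_mat (- (Y $ n) + A_op A G Q \<pi> Y n) (C_op A L Q \<gamma> Y n)
      (ctransp (C_op A L Q \<gamma> Y n)) (R Y n)) \<longleftrightarrow> psd UNIV (Ric Y $ n - Y $ n)"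
    if Y: "Y \<in> HF" and R: "pd UNIV (R Y n)" for n
  proof -
    have "hermitian (- (Y $ n) + A_op A G Q \<pi> Y n)"
      using Y by (intro hermitian_simps A_op_HF HF_hermitian)
    moreover have "mat_over F (block_mat (- (Y $ n) + A_op A G Q \<pi> Y n) (C_op A L Q \<gamma> Y n)
      (ctransp (C_op A L Q \<gamma> Y n)) (R Y n))"
      using Y by (intro mat_over_block_mat overs A_op_HF HF_over C_op_over R_over)
    ultimately show ?thesis
      by (simp add: schur_complement[OF _ R] psd_over_UNIV[OF F] del: add_uminus_conv_diff uminus_add_conv_diff)
        (simp add: Y_op_def algebra_simps)
  qed
  then show "Y \<in> LMI_feasible F A L G H Q \<pi> \<gamma> \<longleftrightarrow> Y \<in> MM"
    unfolding M_set_iff LMI_feasible_def using R_pd_iff by auto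
qed

text \<open>
  One step of the filter with a prescribed gain \<open>K\<close>. The Riccati operator is the minimum of
  these affine monotone maps over all gains.
\<close>

definition gain_step :: "complex^'y^'x^'i \<Rightarrow> complex^'x^'x^'i \<Rightarrow> complex^'x^'x^'i" where
  "gain_step K Y = V_op A L Q \<gamma> K Y + (\<chi> n. \<pi> $ n *\<^sub>R (G ** ctransp G)
     + (\<gamma> $ n * \<pi> $ n) *\<^sub>R (K $ n ** (H ** ctransp H) ** ctransp (K $ n)))"

text \<open>The minimising gain, a Kalman gain with the sign fitting \<open>A + K L\<close>. It
  contains no \<open>sqrt (\<gamma> $ n)\<close>, since \<open>\<gamma> $ n\<close> multiplies the
  whole square in the gain.\<close>

definition riccati_gain :: "complex^'x^'x^'i \<Rightarrow> complex^'y^'x^'i" where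
  "riccati_gain Y = (\<chi> n. - (A ** D Y n ** ctransp L ** matrix_inv (R Y n)))"

text \<open>Completing the square in \<open>K\<close>: the gain-dependent part of the step is
  \<open>\<gamma> $ n\<close> times \<open>B K* + K B* + K R K*\<close> with
  \<open>B = A D L*\<close>, and its minimum over \<open>K\<close> is reached at \<open>- B\<close>
  times the inverse of \<open>R\<close>.\<close>

lemma gain_step_minus_Ric:
  assumes Y: "Y \<in> HF" and inv: "invertible (R Y n)"
  shows "gain_step K Y $ n - Ric Y $ n
    = \<gamma> $ n *\<^sub>R ((K $ n - riccati_gain Y $ n) ** R Y n ** ctransp (K $ n - riccati_gain Y $ n))"
proof -
  let ?D = "D Y n" and ?R = "R Y n" and ?K = "K $ n"
  define B where "B = A ** ?D ** ctransp L"
  have D: "ctransp ?D = ?D"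
    using D_hermitian[OF Y] by (simp add: hermitian_def)
  have Bs: "ctransp B = L ** ?D ** ctransp A"
    by (simp add: B_def ctransp_mult D matrix_mul_assoc)
  have I: "ctransp (matrix_inv ?R) = matrix_inv ?R"
    by (rule hermitian_matrix_inv[OF R_hermitian[OF Y] inv])
  have IR: "matrix_inv ?R ** ?R = mat 1" "?R ** matrix_inv ?R = mat 1"
    using inv by (simp_all add: matrix_inv_left matrix_inv_right)
  \<comment> \<open>The factors \<open>sqrt (\<gamma> $ n)\<close> of the two occurrences of
    \<open>C_op\<close> multiply to \<open>\<gamma> $ n\<close>.\<close>
  have Ric: "Ric Y $ n = A ** ?D ** ctransp A + \<pi> $ n *\<^sub>R (G ** ctransp G)
      - \<gamma> $ n *\<^sub>R (B ** matrix_inv ?R ** ctransp B)"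
    using \<gamma>_nonneg[of n] by (simp add: Y_op_def A_op_def C_op_def B_def mmul_simps)
  have KRK: "?K ** ?R ** ctransp ?K = \<pi> $ n *\<^sub>R (?K ** (H ** ctransp H) ** ctransp ?K)
      + ?K ** L ** ?D ** ctransp L ** ctransp ?K"
    by (simp add: R_op_def mmul_simps matrix_add_ldistrib matrix_mul_assoc)
  have step: "gain_step K Y $ n = A ** ?D ** ctransp A + \<pi> $ n *\<^sub>R (G ** ctransp G)
      + \<gamma> $ n *\<^sub>R (B ** ctransp ?K + ?K ** ctransp B + ?K ** ?R ** ctransp ?K)"
    unfolding KRK Bs
    by (simp add: gain_step_def V_op_def B_def ctransp_mult mmul_simps matrix_add_ldistrib
        matrix_mul_assoc algebra_simps)
  have "(?K + B ** matrix_inv ?R) ** ?R ** ctransp (?K + B ** matrix_inv ?R)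
      = ?K ** ?R ** ctransp ?K + ?K ** (?R ** matrix_inv ?R) ** ctransp B
        + B ** (matrix_inv ?R ** ?R) ** ctransp ?K
        + B ** (matrix_inv ?R ** ?R) ** matrix_inv ?R ** ctransp B"
    by (simp add: ctransp_mult I mmul_simps matrix_add_ldistrib matrix_mul_assoc)
  then have square: "(?K + B ** matrix_inv ?R) ** ?R ** ctransp (?K + B ** matrix_inv ?R)
      = ?K ** ?R ** ctransp ?K + ?K ** ctransp B + B ** ctransp ?K + B ** matrix_inv ?R ** ctransp B"
    by (simp add: IR)
  have "gain_step K Y $ n - Ric Y $ n
      = \<gamma> $ n *\<^sub>R ((?K + B ** matrix_inv ?R) ** ?R ** ctransp (?K + B ** matrix_inv ?R))"
    unfolding square step Ric by (simp add: algebra_simps)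
  then show ?thesis
    by (simp add: riccati_gain_def B_def)
qed

lemma Ric_le_gain_step:
  assumes "Y \<in> HF" "pd UNIV (R Y n)"
  shows "psd UNIV (gain_step K Y $ n - Ric Y $ n)"
  unfolding gain_step_minus_Ric[OF assms(1) pd_invertible[OF assms(2)]]
  by (intro psd_scaleR psd_congruence pd_imp_psd assms \<gamma>_nonneg)

lemma gain_step_riccati_gain:
  assumes "Y \<in> HF" "pd UNIV (R Y n)"
  shows "gain_step (riccati_gain Y) Y $ n = Ric Y $ n"
  using gain_step_minus_Ric[OF assms(1) pd_invertible[OF assms(2)], of "riccati_gain Y"]
  by (simp add: mmul_simps)

lemma V_op_psd:
  assumes "\<And>n. psd UNIV (Y $ n)"
  shows "psd UNIV (V_op A L Q \<gamma> K Y $ n)"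
  unfolding V_op_def vec_lambda_beta using \<gamma>_nonneg[of n] \<gamma>_le_1[of n]
  by (intro psd_add psd_scaleR psd_congruence D_psd assms) simp_all

lemma gain_step_diff: "gain_step K Y - gain_step K Z = V_op A L Q \<gamma> K (Y - Z)"
  by (simp add: gain_step_def linear_diff[OF linear_V_op])

text \<open>Freezing the gain that is optimal for the larger tuple \<open>Y\<close> gives a monotone
  map \<open>T\<close> with \<open>Ric Y = T Y\<close>, \<open>T Y\<close> above \<open>T Z\<close>,
  and \<open>T Z\<close> above \<open>Ric Z\<close>.\<close>

lemma Ric_mono:
  assumes Y: "Y \<in> HF" "\<And>n. pd UNIV (R Y n)" and Z: "Z \<in> HF" "\<And>n. pd UNIV (R Z n)"
    and le: "\<And>n. psd UNIV (Y $ n - Z $ n)"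
  shows "psd UNIV (Ric Y $ n - Ric Z $ n)"
proof -
  let ?T = "gain_step (riccati_gain Y)"
  have "psd UNIV ((?T Y - ?T Z) $ n)"
    unfolding gain_step_diff by (rule V_op_psd) (simp add: le)
  then have "psd UNIV (?T Y $ n - ?T Z $ n)"
    by simp
  then have "psd UNIV (?T Y $ n - Ric Z $ n)"
    using Ric_le_gain_step[OF Z] by (rule psd_diff_trans)
  then show ?thesis
    by (simp add: gain_step_riccati_gain Y)
qed

text \<open>Forces every upper bound of \<open>MM\<close> to be positive semidefinite, so that
  \<open>R_pd\<close> applies to it.\<close>

lemma zero_in_M_set: "0 \<in> MM"
proof -
  have 0: "0 \<in> nonneg_tuples"
    using subspace_0[OF subspace_hermitian_tuples[OF F]] by (simp add: nonneg_tuples_def psd_0)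
  moreover have "Ric 0 $ n = \<pi> $ n *\<^sub>R (G ** ctransp G)" for n
    by (simp add: Y_op_def A_op_def C_op_def D_op_simps mmul_simps)
  then have "psd UNIV (Ric 0 $ n - 0 $ n)" for n
    using \<pi>_pos[of n] by (simp add: psd_scaleR psd_mult_ctransp)
  ultimately show ?thesis
    using R_pd[OF 0] by (simp add: M_set_iff nonneg_tuples_def)
qed

lemma closed_tuple_psd: "closed {Y :: complex^'x^'x^'i. psd UNIV (Y $ n - X)}"
  using continuous_closed_vimage[OF closed_psd, of "\<lambda>Y. Y $ n - X"]
  by (simp add: vimage_def continuous_intros)

lemma closed_nonneg_tuples: "closed nonneg_tuples"
proof -
  have "nonneg_tuples = HF \<inter> (\<Inter>n. {Y. psd UNIV (Y $ n - 0)})"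
    by (auto simp: nonneg_tuples_def)
  then show ?thesis
    by (simp only:) (intro closed_Int closed_INT ballI closed_tuple_psd
        closed_subspace[OF subspace_hermitian_tuples[OF F]])
qed

lemma continuous_on_Ric:
  assumes "\<And>Y n. Y \<in> S \<Longrightarrow> invertible (R Y n)"
  shows "continuous_on S Ric"
proof -
  have "continuous_on S (\<lambda>Y. R Y n)" for n
    unfolding R_op_def
    by (intro continuous_intros continuous_on_matrix_mult continuous_on_D_op)
  then show ?thesis
    unfolding Y_op_def A_op_def C_op_def
    by (intro continuous_intros continuous_on_matrix_mult continuous_on_D_op
        continuous_on_ctransp continuous_on_matrix_inv assms)
qed

lemma V_op_HF:
  assumes K: "\<And>n. mat_over F (K $ n)" and Y: "Y \<in> HF"
  shows "V_op A L Q \<gamma> K Y \<in> HF"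
  unfolding V_op_def hermitian_tuples_def
  by (auto simp del: ctransp_simps intro!: hermitian_simps overs K D_hermitian D_over Y)

text \<open>
  The fixed point for a stabilising gain is an upper bound of the feasible set, because a feasible
  \<open>Z\<close> lies below \<open>gain_step K Z\<close>.
\<close>

lemma gain_step_fixpoint_bound:
  assumes K: "\<And>n. mat_over F (K $ n)" and stable: "operator_spectral_radius (V_op A L Q \<gamma> K) < 1"
  shows "\<exists>Y\<in>HF. gain_step K Y = Y \<and> (\<forall>Z\<in>MM. \<forall>n. psd UNIV (Y $ n - Z $ n))"
proof -
  let ?V = "V_op A L Q \<gamma> K"
  have sub: "subspace HF"
    by (rule subspace_hermitian_tuples[OF F])
  have inj: "x = 0" if "0 \<le> s" "s \<le> 1" "x = s *\<^sub>R ?V x" for s x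
    by (rule no_eigenvalue_outside_disc[OF linear_V_op V_op_complex_scale stable that])
  have maps: "?V ` HF \<subseteq> HF"
    using V_op_HF[OF K] by blast
  have "gain_step K 0 \<in> HF"
    unfolding gain_step_def linear_0[OF linear_V_op] hermitian_tuples_def
    by (auto intro!: hermitian_simps overs K)
  \<comment> \<open>Solving inside \<open>HF\<close> keeps the fixed point Hermitian with entries in
    \<open>F\<close>; injectivity is the case \<open>s = 1\<close> of \<open>inj\<close>.\<close>
  moreover have "(\<lambda>x. x - ?V x) ` HF = HF"
  proof (rule linear_inj_on_subspace_imp_onto[OF _ sub])
    show "linear (\<lambda>x. x - ?V x)"
      by (intro linear_compose_sub linear_id[unfolded id_def] linear_V_op)
    show "(\<lambda>x. x - ?V x) ` HF \<subseteq> HF"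
      using maps subspace_diff[OF sub] by blast
    show "x = 0" if "x - ?V x = 0" for x
      using inj[of 1 x] that by simp
  qed
  ultimately obtain Y where Y: "Y \<in> HF" "Y - ?V Y = gain_step K 0"
    by (metis (no_types, lifting) imageE)
  have "gain_step K Y = ?V Y + gain_step K 0"
    using gain_step_diff[of K Y 0] by (simp add: algebra_simps)
  then have fixp: "gain_step K Y = Y"
    using Y(2) by (simp add: algebra_simps)
  have "Y - Z \<in> nonneg_tuples" if Z: "Z \<in> MM" for Z
  proof (rule positive_resolvent[OF linear_V_op sub maps inj _ closed_nonneg_tuples])
    show "nonneg_tuples \<subseteq> HF"
      by (auto simp: nonneg_tuples_def)
    show "x + y \<in> nonneg_tuples" if "x \<in> nonneg_tuples" "y \<in> nonneg_tuples" for x y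
      using that sub by (simp add: nonneg_tuples_def psd_add subspace_add)
    show "c *\<^sub>R x \<in> nonneg_tuples" if "0 \<le> c" "x \<in> nonneg_tuples" for c x
      using that sub by (simp add: nonneg_tuples_def psd_scaleR subspace_scale)
    show "?V ` nonneg_tuples \<subseteq> nonneg_tuples"
      using V_op_HF[OF K] by (auto simp: nonneg_tuples_def V_op_psd)
    show "(\<chi> n. mat 1) \<in> HF"
      by (simp add: hermitian_tuples_def hermitian_simps overs)
    show "0 < 1 / (real CARD('x))\<^sup>2"
      by simp
    show "x \<in> nonneg_tuples" if x: "x \<in> HF" "norm (x - (\<chi> n. mat 1)) < 1 / (real CARD('x))\<^sup>2" for x
    proof -
      have "norm (x $ n - mat 1) \<le> norm (x - (\<chi> n. mat 1))" for n
        using Finite_Cartesian_Product.norm_nth_le[of "x - (\<chi> n. mat 1)" n] by simp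
      then have "psd UNIV (x $ n)" for n
        using HF_hermitian[OF x(1)] x(2) by (intro psd_near_mat1) (auto intro: order.strict_trans1)
      then show ?thesis
        using x(1) by (simp add: nonneg_tuples_def)
    qed
    show YZ: "Y - Z \<in> HF"
      using Y(1) M_set_HF[OF Z] by (rule subspace_diff[OF sub])
    \<comment> \<open>As \<open>Y\<close> is fixed by the step, the resolvent equation for
      \<open>Y - Z\<close> has right-hand side \<open>gain_step K Z - Z\<close>, which is positive
      semidefinite because \<open>gain_step K Z\<close> lies above \<open>Ric Z\<close> and
      \<open>Ric Z\<close> above \<open>Z\<close>.\<close>
    have eq: "Y - Z - ?V (Y - Z) = gain_step K Z - Z"
      using gain_step_diff[of K Y Z] by (simp add: fixp algebra_simps)
    have "psd UNIV (gain_step K Z $ n - Z $ n)" for n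
      using Z by (intro psd_diff_trans[OF Ric_le_gain_step]) (auto simp: M_set_iff)
    moreover have "Y - Z - ?V (Y - Z) \<in> HF"
      using YZ V_op_HF[OF K YZ] by (rule subspace_diff[OF sub])
    ultimately show "Y - Z - ?V (Y - Z) \<in> nonneg_tuples"
      unfolding eq by (simp add: nonneg_tuples_def)
  qed
  then have "\<forall>Z\<in>MM. \<forall>n. psd UNIV (Y $ n - Z $ n)"
    by (auto simp: nonneg_tuples_def)
  then show ?thesis
    using Y(1) fixp by blast
qed

lemma maximal_CARE_solution_iff:
  "maximal_CARE_solution F A L G H Q \<pi> \<gamma> Y \<longleftrightarrow>
     Y \<in> MM \<and> Ric Y = Y \<and> (\<forall>Z\<in>MM. \<forall>n. psd UNIV (Y $ n - Z $ n))"
  unfolding maximal_CARE_solution_def filtering_CARE_def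
  using tuple_ge_iff M_set_HF by (auto simp: vec_eq_iff[where x=Y] vec_eq_iff[where y=Y])

theorem maximal_CARE_solution_exists:
  assumes "mean_square_detectable F A L Q \<gamma>"
  shows "\<exists>Y. maximal_CARE_solution F A L G H Q \<pi> \<gamma> Y"
proof -
  obtain K :: "complex^'y^'x^'i" where K: "\<And>n. mat_over F (K $ n)"
      "operator_spectral_radius (V_op A L Q \<gamma> K) < 1"
    using assms unfolding mean_square_detectable_def by blast
  obtain Y0 where Y0: "Y0 \<in> HF" "gain_step K Y0 = Y0" "\<And>Z n. Z \<in> MM \<Longrightarrow> psd UNIV (Y0 $ n - Z $ n)"
    using gain_step_fixpoint_bound[OF K] by blast
  \<comment> \<open>Domination of the zero tuple makes members semidefinite, and then the trace
    bounds the norm. The cap is on the trace, so any Riccati step that goes down respects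
    it.\<close>
  define B where "B = {Y \<in> HF. (\<forall>Z\<in>MM. \<forall>n. psd UNIV (Y $ n - Z $ n)) \<and> trace_objective Y \<le> trace_objective Y0}"
  have B_nonneg: "B \<subseteq> nonneg_tuples"
    using zero_in_M_set by (fastforce simp: B_def nonneg_tuples_def)
  have B_pd: "pd UNIV (R Y n)" if "Y \<in> B" for Y n
    using that B_nonneg R_pd by blast
  have B_HF: "Y \<in> HF" if "Y \<in> B" for Y
    using that by (simp add: B_def)
  have cont_trace: "continuous_on S (trace_objective :: complex^'x^'x^'i \<Rightarrow> real)" for S
    unfolding trace_objective_def trace_def by (intro continuous_intros)
  have B_eq: "B = HF \<inter> (\<Inter>Z\<in>MM. \<Inter>n. {Y. psd UNIV (Y $ n - Z $ n)}) \<inter> {Y. trace_objective Y \<le> trace_objective Y0}"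
    by (auto simp: B_def)
  have closed_trace: "closed {Y :: complex^'x^'x^'i. trace_objective Y \<le> trace_objective Y0}"
    by (intro closed_Collect_le cont_trace continuous_intros)
  have "closed B"
    unfolding B_eq by (intro closed_Int closed_INT ballI closed_tuple_psd
        closed_subspace[OF subspace_hermitian_tuples[OF F]] closed_trace)
  moreover have "bounded B"
  proof -
    have "norm Y \<le> real CARD('i) * real CARD('x) * real CARD('x) * trace_objective Y0" if "Y \<in> B" for Y
    proof -
      have "norm Y \<le> real CARD('i) * real CARD('x) * real CARD('x) * trace_objective Y"
        using that B_nonneg by (intro tuple_psd_norm_le) (auto simp: nonneg_tuples_def)
      also have "\<dots> \<le> real CARD('i) * real CARD('x) * real CARD('x) * trace_objective Y0"
        using that by (intro mult_left_mono) (auto simp: B_def)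
      finally show ?thesis .
    qed
    then show ?thesis
      unfolding bounded_iff by blast
  qed
  ultimately have compB: "compact B"
    by (simp add: compact_eq_bounded_closed)
  define S where "S = {Y \<in> B. \<forall>n. psd UNIV (Y $ n - Ric Y $ n)}"
  have "continuous_on B (\<lambda>Y. Y $ n - Ric Y $ n)" for n
    using B_pd pd_invertible by (intro continuous_intros continuous_on_Ric) blast
  then have "closed (B \<inter> (\<lambda>Y. Y $ n - Ric Y $ n) -` {M. psd UNIV M})" for n
    using closed_psd compact_imp_closed[OF compB] by (intro continuous_closed_preimage)
  then have "closed (\<Inter>n. B \<inter> (\<lambda>Y. Y $ n - Ric Y $ n) -` {M. psd UNIV M})"
    by (intro closed_INT ballI)
  moreover have "S = (\<Inter>n. B \<inter> (\<lambda>Y. Y $ n - Ric Y $ n) -` {M. psd UNIV M})"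
    by (auto simp: S_def)
  ultimately have "closed S"
    by (simp only:)
  then have "compact (B \<inter> S)"
    by (rule compact_Int_closed[OF compB])
  moreover have "B \<inter> S = S"
    by (auto simp: S_def)
  ultimately have compS: "compact S"
    by (simp only:)
  have Y0B: "Y0 \<in> B"
    using Y0 by (simp add: B_def)
  \<comment> \<open>For the gain \<open>K\<close>, \<open>Y0\<close> equals its own step, which lies
    above \<open>Ric Y0\<close>.\<close>
  then have "Y0 \<in> S"
    using Ric_le_gain_step[OF Y0(1) B_pd[OF Y0B], where K = K] Y0(2) by (simp add: S_def)
  then have "S \<noteq> {}"
    by blast
  then have "\<exists>Y\<in>S. \<forall>Z\<in>S. trace_objective Y \<le> trace_objective Z"
    by (rule continuous_attains_inf[OF compS _ cont_trace])
  then obtain Y where Y: "Y \<in> S" "\<And>Z. Z \<in> S \<Longrightarrow> trace_objective Y \<le> trace_objective Z"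
    by blast
  have YB: "Y \<in> B" and dec: "psd UNIV (Y $ n - Ric Y $ n)" for n
    using Y(1) by (auto simp: S_def)
  \<comment> \<open>\<open>Ric Y\<close> lies above \<open>Ric Z\<close> by monotonicity, and
    \<open>Ric Z\<close> above \<open>Z\<close> by feasibility.\<close>
  have ge: "psd UNIV (Ric Y $ n - Z $ n)" if "Z \<in> MM" for Z n
  proof (rule psd_diff_trans[OF Ric_mono])
    show "psd UNIV (Ric Z $ n - Z $ n)" "Z \<in> HF" "pd UNIV (R Z n)" for n
      using that by (auto simp: M_set_iff)
    show "psd UNIV (Y $ n - Z $ n)" for n
      using YB that by (simp add: B_def)
  qed (use YB B_HF B_pd in auto)
  have "trace_objective (Ric Y) \<le> trace_objective Y"
    by (rule tuple_psd_trace_mono[OF dec])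
  then have RB: "Ric Y \<in> B"
    using YB ge Ric_HF[OF B_HF[OF YB]] B_pd[OF YB] pd_invertible by (auto simp: B_def)
  \<comment> \<open>Monotonicity applied to the pair \<open>Y\<close>, \<open>Ric Y\<close>: the
    decrease is inherited by the next iterate.\<close>
  have "psd UNIV (Ric Y $ n - Ric (Ric Y) $ n)" for n
    by (intro Ric_mono dec B_HF B_pd YB RB)
  then have "Ric Y \<in> S"
    using RB by (simp add: S_def)
  \<comment> \<open>\<open>Y\<close> lies above \<open>Ric Y\<close>, yet by minimality its trace is
    not larger.\<close>
  then have "Y = Ric Y"
    by (intro tuple_psd_trace_eq dec Y(2))
  then have fixp: "Ric Y = Y"
    by (rule sym)
  have "Y \<in> MM"
    by (simp add: M_set_iff fixp B_HF[OF YB] B_pd[OF YB] psd_0)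
  then show ?thesis
    using fixp YB unfolding maximal_CARE_solution_iff B_def by blast
qed

lemma maximal_CARE_solution_imp_convex_program_solution:
  assumes "maximal_CARE_solution F A L G H Q \<pi> \<gamma> Y"
  shows "convex_program_solution F A L G H Q \<pi> \<gamma> Y"
  using assms tuple_psd_trace_mono
  unfolding maximal_CARE_solution_iff convex_program_solution_def LMI_feasible_eq_M_set by blast

lemma convex_program_solution_unique:
  assumes "maximal_CARE_solution F A L G H Q \<pi> \<gamma> Y" "convex_program_solution F A L G H Q \<pi> \<gamma> Z"
  shows "Z = Y"
proof -
  have "Y = Z"
    using assms unfolding maximal_CARE_solution_iff convex_program_solution_def LMI_feasible_eq_M_set
    by (intro tuple_psd_trace_eq) auto
  then show ?thesis
    by simp
qed

end

theorem theorem1: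
  fixes F :: "complex set"
    and A :: "complex^'x^'x" and L :: "complex^'x^'y"
    and G :: "complex^'w^'x" and H :: "complex^'w^'y"
    and Q :: "real^'i^'i" and \<pi> :: "real^'i" and \<gamma> :: "real^'i"
  assumes "F = \<real> \<or> F = UNIV"
    and "mat_over F A" and "mat_over F L" and "mat_over F G" and "mat_over F H"
    and "psd F (G ** ctransp G)" and "G ** ctransp H = 0" and "pd F (H ** ctransp H)"
    and "ergodic_chain Q" and "stationary_distribution Q \<pi>"
    and "\<And>n. 0 \<le> \<gamma> $ n \<and> \<gamma> $ n \<le> 1"
    and "mean_square_detectable F A L Q \<gamma>"
  shows "((\<exists>Yplus. maximal_CARE_solution F A L G H Q \<pi> \<gamma> Yplus) \<longleftrightarrow>
           (\<exists>Yhat. convex_program_solution F A L G H Q \<pi> \<gamma> Yhat)) \<and>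
         (\<forall>Yplus Yhat. maximal_CARE_solution F A L G H Q \<pi> \<gamma> Yplus \<longrightarrow>
           convex_program_solution F A L G H Q \<pi> \<gamma> Yhat \<longrightarrow> Yhat = Yplus)"
proof -
  interpret filtering F A L G H Q \<pi> \<gamma>
    using assms stationary_distribution_pos
    by unfold_locales (auto simp: ergodic_chain_def stochastic_matrix_def)
  \<comment> \<open>Under detectability both existence statements hold, which gives the equivalence;
    the second conjunct is uniqueness of the maximiser.\<close>
  show ?thesis
    using maximal_CARE_solution_exists[OF assms(12)] convex_program_solution_unique
      maximal_CARE_solution_imp_convex_program_solution
    by blast
qed

end
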